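(* Let $n,k$ be positive integers with $n\ge\binom{k+1}{2}$. The posets $NG_1^*(n,k)$ and $NG_2^*(n,k)$ are amphoras in $S\text{-}Block(n)$. Moreover, there is a bijection that preserves majorization between $NG_1^*(n,k)$ and the amphora $A(n-k,k-1)$, and there is a bijection that preserves majorization between $NG_2^*(n,k)$ and the amphora $A(n-k,k)$.
   Context: $Dis(n)$ is the set of partitions $\gamma=(g_1,\dots,g_r)$ of $n$ into distinct positive parts $g_1>\dots>g_r>0$, with $\mathrm{len}(\gamma)=r$; $Dis_k(n)$ is the subset of those with exactly $k$ parts. (Degenerate cases: $Dis_0(0)$ consists of the empty partition only and $Dis_0(n)=\emptyset$ for $n\geq 1$; $Dis_k(0)=\emptyset$ for $k\ge1$.) For $\gamma=(g_1,\dots,g_r)$ and $\delta=(d_1,\dots,d_s)$ in $Dis(n)$, $\delta\succeq\gamma$ ($\delta$ majorizes $\gamma$) means $\sum_{i=1}^m d_i\ge\sum_{i=1}^m g_i$ for all $m\le\min\{r,s\}$. An $S$-block is an ordered pair $[\alpha|\beta]$ with $\alpha,\beta\in Dis(n)$, $\beta\succeq\alpha$, and $\mathrm{len}(\alpha)\in\{\mathrm{len}(\beta),\mathrm{len}(\beta)+1\}$. $S\text{-}Block(n)$ is the poset of all such $S$-blocks, where $[\alpha_1|\beta_1]$ majorizes $[\alpha_2|\beta_2]$, written $[\alpha_1|\beta_1]\succeq[\alpha_2|\beta_2]$, iff $\alpha_1\succeq\alpha_2$ and $\beta_1\preceq\beta_2$. $A(n,k)$ is the subposet of $S$-blocks $[\alpha|\beta]$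 with $\alpha,\beta\in Dis_k(n)$ (empty when $n<\binom{k+1}{2}$). A bijection $\varphi$ between two posets of blocks preserves majorization if $x\succeq y\iff\varphi(x)\succeq\varphi(y)$. Graphs are finite and simple, without isolated vertices. For a degree sequence $\pi=(d_1\ge\dots\ge d_r)$, $\alpha(\pi)$ has $i$-th part $d_i-i+1$ for those $i$ with $d_i\ge i$, and $\beta(\pi)$ has $j$-th part $|\{i:d_i\ge j\}|-j$ for those $j$ for which this is positive. A graph $G$ is an NG-graph if $\chi(G)+\chi(\overline G)=|V(G)|+1$. With $A_G=\{v:\deg(v)=\chi(G)-1\}$, an NG-graph is NG-1 if $G[A_G]$ is a clique and NG-2 if $G[A_G]$ is a stable set. An $S$-block $[\alpha|\beta]$ is called NG-1 (resp. NG-2) if there is an NG-1 (resp. NG-2) graph with degree sequence $\pi$ such that $\alpha=\alpha(\pi)$, $\beta=\beta(\pi)$. $NG_1(n,k)$ (resp. $NG_2(n,k)$) is the subposet of $A(n,k)$ consisting of its NG-1 (resp. NG-2) $S$-blocks. $NG_1^*(n,k)$ is the subposet of $NG_1(n,k)$ consisting of those $S$-blocks not in $NG_2(n,k)$, and $NG_2^*(n,k)$ is the subposet of $NG_2(n,k)$ consisting of those $S$-blocks not in $NG_1(n,k)$. Given a poset $P$, a subposet $P'$ is an amphora if there exist an antichain $A$ in $P$ and an element $x$ less than or equal to every element of $A$ such that $P'$ consists of all elements of $P$ that are greater than or equal to $x$ and less than or equal to some element of $A$. The antichain $A$ may be empty, so the empty set counts as an amphora. *)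

theory Defs
  imports Complex_Main "HOL-Library.Multiset" "HOL-Library.Ramsey"
begin

section \<open>Partitions into distinct parts and majorization\<close>

text \<open>A partition is the strictly decreasing list of its parts.\<close>

definition Dis :: "nat \<Rightarrow> nat list set" where
  "Dis n = {\<gamma>. sorted_wrt (>) \<gamma> \<and> (\<forall>g\<in>set \<gamma>. 0 < g) \<and> sum_list \<gamma> = n}"

definition Dis_parts :: "nat \<Rightarrow> nat \<Rightarrow> nat list set" where
  "Dis_parts k n = {\<gamma> \<in> Dis n. length \<gamma> = k}"

definition majorizes :: "nat list \<Rightarrow> nat list \<Rightarrow> bool" (infix \<open>\<succeq>\<close> 50) where
  "\<delta> \<succeq> \<gamma> \<longleftrightarrow>
     (\<forall>m \<le> min (length \<gamma>) (length \<delta>). sum_list (take m \<gamma>) \<le> sum_list (take m \<delta>))"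


section \<open>S-blocks\<close>

text \<open>The pair \<open>(\<alpha>, \<beta>)\<close> stands for the block \<open>[\<alpha>|\<beta>]\<close>.\<close>

type_synonym block = "nat list \<times> nat list"

definition S_Block :: "nat \<Rightarrow> block set" where
  "S_Block n = {(\<alpha>, \<beta>). \<alpha> \<in> Dis n \<and> \<beta> \<in> Dis n \<and> \<beta> \<succeq> \<alpha> \<and>
                  length \<alpha> \<in> {length \<beta>, length \<beta> + 1}}"

definition block_majorizes :: "block \<Rightarrow> block \<Rightarrow> bool" (infix \<open>\<succeq>\<^sub>S\<close> 50) where
  "b1 \<succeq>\<^sub>S b2 \<longleftrightarrow> fst b1 \<succeq> fst b2 \<and> snd b2 \<succeq> snd b1"

definition A_blocks :: "nat \<Rightarrow> nat \<Rightarrow> block set" where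
  "A_blocks n k = {b \<in> S_Block n. fst b \<in> Dis_parts k n \<and> snd b \<in> Dis_parts k n}"


section \<open>Finite simple graphs\<close>

text \<open>
  A graph is a vertex set \<open>V\<close> together with a set \<open>E\<close> of two-element subsets of \<open>V\<close>;
  \<open>[V]\<^bsup>2\<^esup>\<close>, \<^const>\<open>clique\<close> and \<^const>\<open>indep\<close> are those of \<^theory>\<open>HOL-Library.Ramsey\<close>.
  The edge set of the complementary graph is \<open>[V]\<^bsup>2\<^esup> - E\<close>.
\<close>

definition simple_graph :: "'v set \<Rightarrow> 'v set set \<Rightarrow> bool" where
  "simple_graph V E \<longleftrightarrow> finite V \<and> E \<subseteq> [V]\<^bsup>2\<^esup>"

definition vdeg :: "'v set set \<Rightarrow> 'v \<Rightarrow> nat" where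
  "vdeg E v = card {e \<in> E. v \<in> e}"

definition no_isolated_vertices :: "'v set \<Rightarrow> 'v set set \<Rightarrow> bool" where
  "no_isolated_vertices V E \<longleftrightarrow> (\<forall>v\<in>V. vdeg E v \<noteq> 0)"

definition proper_coloring :: "'v set \<Rightarrow> 'v set set \<Rightarrow> nat \<Rightarrow> ('v \<Rightarrow> nat) \<Rightarrow> bool" where
  "proper_coloring V E c f \<longleftrightarrow>
     f ` V \<subseteq> {..<c} \<and> (\<forall>u\<in>V. \<forall>v\<in>V. {u, v} \<in> E \<longrightarrow> f u \<noteq> f v)"

definition chromatic_number :: "'v set \<Rightarrow> 'v set set \<Rightarrow> nat" where
  "chromatic_number V E = (LEAST c. \<exists>f. proper_coloring V E c f)"

definition NG_graph :: "'v set \<Rightarrow> 'v set set \<Rightarrow> bool" where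
  "NG_graph V E \<longleftrightarrow> simple_graph V E \<and> no_isolated_vertices V E \<and>
     chromatic_number V E + chromatic_number V ([V]\<^bsup>2\<^esup> - E) = card V + 1"

definition A_vertices :: "'v set \<Rightarrow> 'v set set \<Rightarrow> 'v set" where
  "A_vertices V E = {v \<in> V. vdeg E v = chromatic_number V E - 1}"

definition NG1_graph :: "'v set \<Rightarrow> 'v set set \<Rightarrow> bool" where
  "NG1_graph V E \<longleftrightarrow> NG_graph V E \<and> clique (A_vertices V E) E"

definition NG2_graph :: "'v set \<Rightarrow> 'v set set \<Rightarrow> bool" where
  "NG2_graph V E \<longleftrightarrow> NG_graph V E \<and> indep (A_vertices V E) E"


section \<open>The block of a degree sequence\<close>

definition degree_sequence :: "'v set \<Rightarrow> 'v set set \<Rightarrow> nat list" where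
  "degree_sequence V E = rev (sorted_list_of_multiset (image_mset (vdeg E) (mset_set V)))"

text \<open>
  With \<open>\<pi> = (d\<^sub>1 \<ge> \<dots> \<ge> d\<^sub>r)\<close>, list positions start at 0, so \<open>\<pi> ! i\<close> is
  \<open>d\<^bsub>i+1\<^esub>\<close> and the part \<open>d\<^bsub>i+1\<^esub> - (i+1) + 1\<close> becomes \<open>\<pi> ! i - i\<close>.
  In \<open>beta_part\<close> the index \<open>j\<close> is not shifted; a positive part requires \<open>j < r\<close>, and the
  truncated difference is positive exactly if the true one is.
\<close>

definition alpha_part :: "nat list \<Rightarrow> nat list" where
  "alpha_part \<pi> = [\<pi> ! i - i. i \<leftarrow> [0..<length \<pi>], i + 1 \<le> \<pi> ! i]"

definition beta_part :: "nat list \<Rightarrow> nat list" where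
  "beta_part \<pi> = filter (\<lambda>p. 0 < p)
     [card {i. i < length \<pi> \<and> j \<le> \<pi> ! i} - j. j \<leftarrow> [1..<length \<pi> + 1]]"


section \<open>NG-1 and NG-2 blocks\<close>

text \<open>
  Every finite graph is isomorphic to one with vertices in \<^typ>\<open>nat\<close>, so it suffices to let the
  witnessing graph range over these.
\<close>

definition NG1_block :: "block \<Rightarrow> bool" where
  "NG1_block b \<longleftrightarrow> (\<exists>(V :: nat set) E. NG1_graph V E \<and>
     fst b = alpha_part (degree_sequence V E) \<and> snd b = beta_part (degree_sequence V E))"

definition NG2_block :: "block \<Rightarrow> bool" where
  "NG2_block b \<longleftrightarrow> (\<exists>(V :: nat set) E. NG2_graph V E \<and>
     fst b = alpha_part (degree_sequence V E) \<and> snd b = beta_part (degree_sequence V E))"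

definition NG1 :: "nat \<Rightarrow> nat \<Rightarrow> block set" where
  "NG1 n k = {b \<in> A_blocks n k. NG1_block b}"

definition NG2 :: "nat \<Rightarrow> nat \<Rightarrow> block set" where
  "NG2 n k = {b \<in> A_blocks n k. NG2_block b}"

definition NG1_star :: "nat \<Rightarrow> nat \<Rightarrow> block set" where
  "NG1_star n k = NG1 n k - NG2 n k"

definition NG2_star :: "nat \<Rightarrow> nat \<Rightarrow> block set" where
  "NG2_star n k = NG2 n k - NG1 n k"


section \<open>Amphoras and majorization-preserving bijections\<close>

text \<open>In the next two definitions \<open>ge a b\<close> means that \<open>a\<close> is above \<open>b\<close>.\<close>

definition antichain_in :: "'a set \<Rightarrow> ('a \<Rightarrow> 'a \<Rightarrow> bool) \<Rightarrow> 'a set \<Rightarrow> bool" where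
  "antichain_in P ge A \<longleftrightarrow> A \<subseteq> P \<and> (\<forall>a\<in>A. \<forall>b\<in>A. a \<noteq> b \<longrightarrow> \<not> ge a b)"

definition amphora_in :: "'a set \<Rightarrow> ('a \<Rightarrow> 'a \<Rightarrow> bool) \<Rightarrow> 'a set \<Rightarrow> bool" where
  "amphora_in P ge Q \<longleftrightarrow>
     (\<exists>A x. antichain_in P ge A \<and> x \<in> P \<and> (\<forall>a\<in>A. ge a x) \<and>
            Q = {p \<in> P. ge p x \<and> (\<exists>a\<in>A. ge a p)})"

definition majorization_bijection :: "(block \<Rightarrow> block) \<Rightarrow> block set \<Rightarrow> block set \<Rightarrow> bool" where
  "majorization_bijection \<phi> P Q \<longleftrightarrow>
     bij_betw \<phi> P Q \<and> (\<forall>x\<in>P. \<forall>y\<in>P. x \<succeq>\<^sub>S y \<longleftrightarrow> \<phi> x \<succeq>\<^sub>S \<phi> y)"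

end

theory Submission
  imports Defs
begin

text \<open>
  For a block \<open>[\<alpha>|\<beta>]\<close> in \<open>A(n, k)\<close> the graph theory collapses to a condition on the smallest parts:
  the block is NG-1 iff the smallest part of \<open>\<beta>\<close> is 1, and NG-2 iff the smallest part of \<open>\<alpha>\<close> is at
  least 2 (\<open>NG_blocks_eq\<close>). Indeed, let \<open>G\<close> be a graph with this block. That \<open>\<alpha>\<close> and \<open>\<beta>\<close> have the
  same sum is equality in the Erdos-Gallai inequality, so \<open>G\<close> is a split graph: the \<open>k\<close> vertices of
  largest degree form a clique \<open>T\<close> and the others a stable set. That \<open>\<alpha>\<close> and \<open>\<beta>\<close> have the same
  length gives a stable vertex \<open>r\<close> of degree \<open>k\<close>, adjacent to all of \<open>T\<close>
  (\<open>A_block_graph_split\<close>). Hence \<open>\<chi>(G) = k + 1\<close>, the complement has chromatic number \<open>|V| - k\<close>, and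
  \<open>G\<close> is an NG-graph whose distinguished vertices are those of degree \<open>k\<close>. They form a clique iff
  \<open>r\<close> is the only one outside \<open>T\<close>, and a stable set iff none lies in \<open>T\<close> (\<open>NG_kind_split\<close>); the
  smallest part of \<open>\<beta>\<close> counts those outside \<open>T\<close>, and the smallest part of \<open>\<alpha>\<close> exceeds by one the
  surplus over \<open>k\<close> of the least degree in \<open>T\<close>. Conversely, every block in \<open>A(n, k)\<close> comes from a
  graph (\<open>A_block_realizable\<close>), by the Gale-Ryser theorem for the edges between clique and stable
  set.

  Since \<open>\<beta>\<close> majorizes \<open>\<alpha>\<close>, its smallest part is at most that of \<open>\<alpha>\<close>. So \<open>NG\<^sub>1\<^sup>*(n, k)\<close> consists of the
  blocks whose two smallest parts are both 1, and \<open>NG\<^sub>2\<^sup>*(n, k)\<close> of those whose smallest parts are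
  both at least 2 (\<open>NG_star_blocks_eq\<close>). Subtracting 1 from every part, and dropping a part that
  becomes 0, is the bijection to \<open>A(n - k, k - 1)\<close> and to \<open>A(n - k, k)\<close>, respectively.

  For the amphoras, a block of \<open>S-Block(n)\<close> above one of \<open>A(n, k)\<close> lies in \<open>A(n, k)\<close> again
  (\<open>A_blocks_upward_closed\<close>), and \<open>A(n, k)\<close>, if not empty, has a least element: the most even \<open>\<alpha>\<close>
  paired with the steepest \<open>\<beta>\<close>. The bijections carry least elements over to the starred families.
  The maximal blocks are the diagonal ones \<open>[\<gamma>|\<gamma>]\<close>, which form an antichain; and as smallest parts
  are monotone, the starred families contain every block of \<open>A(n, k)\<close> between two of their members
  (\<open>amphora_in_S_Block\<close>).
\<close>

section \<open>Partitions into distinct parts and their excess\<close>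

text \<open>
  Consecutive parts differ by at least 1, and these gaps add up.
\<close>

lemma Dis_gap:
  assumes "sorted_wrt (>) \<gamma>" "i \<le> j" "j < length \<gamma>"
  shows "\<gamma> ! j + (j - i) \<le> (\<gamma> ! i :: nat)"
  using assms(2,3)
proof (induction j rule: dec_induct)
  case (step m)
  have "\<gamma> ! m > \<gamma> ! Suc m"
    using assms(1) step.prems by (auto simp: sorted_wrt_iff_nth_less)
  then show ?case using step by simp
qed simp

lemma Dis_nth_ge:
  assumes "\<gamma> \<in> Dis n" "i < length \<gamma>"
  shows "length \<gamma> - i \<le> \<gamma> ! i"
proof -
  have "\<gamma> ! (length \<gamma> - 1) + (length \<gamma> - 1 - i) \<le> \<gamma> ! i"
    using assms by (intro Dis_gap) (auto simp: Dis_def)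
  moreover have "0 < \<gamma> ! (length \<gamma> - 1)"
    using assms by (auto simp: Dis_def)
  ultimately show ?thesis using assms(2) by simp
qed

text \<open>
  Subtracting the staircase \<open>(k, k - 1, \<dots>, 1)\<close> from a partition into \<open>k\<close> distinct parts leaves a
  weakly decreasing sequence of natural numbers. The staircase cancels in every comparison of
  partial sums, so majorization can be read off from these sequences.
\<close>

definition excess :: "nat list \<Rightarrow> nat \<Rightarrow> nat" where
  "excess \<gamma> i = \<gamma> ! i - (length \<gamma> - i)"

definition partition_of_excess :: "nat \<Rightarrow> (nat \<Rightarrow> nat) \<Rightarrow> nat list" where
  "partition_of_excess k f = map (\<lambda>i. k - i + f i) [0..<k]"

lemma nth_excess:
  assumes "\<gamma> \<in> Dis_parts k n" "i < k"
  shows "\<gamma> ! i = k - i + excess \<gamma> i"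
  using assms Dis_nth_ge[of \<gamma> n i] by (auto simp: Dis_parts_def excess_def)

lemma excess_antimono:
  assumes "\<gamma> \<in> Dis_parts k n" "i \<le> j" "j < k"
  shows "excess \<gamma> j \<le> excess \<gamma> i"
proof -
  have "\<gamma> ! j + (j - i) \<le> \<gamma> ! i"
    using assms by (intro Dis_gap) (auto simp: Dis_def Dis_parts_def)
  then show ?thesis
    using nth_excess[OF assms(1), of i] nth_excess[OF assms(1), of j] assms(2,3) by simp
qed

lemma sum_list_take_nth:
  "m \<le> length xs \<Longrightarrow> sum_list (take m xs) = (\<Sum>i<m. xs ! i)"
  by (simp add: sum_list_sum_nth atLeast0LessThan)

lemma sum_take_excess:
  assumes "\<gamma> \<in> Dis_parts k n" "m \<le> k"
  shows "sum_list (take m \<gamma>) = (\<Sum>i<m. k - i) + (\<Sum>i<m. excess \<gamma> i)"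
proof -
  have "sum_list (take m \<gamma>) = (\<Sum>i<m. \<gamma> ! i)"
    using assms by (intro sum_list_take_nth) (auto simp: Dis_parts_def)
  also have "\<dots> = (\<Sum>i<m. k - i + excess \<gamma> i)"
    using assms by (intro sum.cong nth_excess[OF assms(1)]) auto
  finally show ?thesis by (simp add: sum.distrib)
qed

lemma sum_excess:
  assumes "\<gamma> \<in> Dis_parts k n"
  shows "n = (\<Sum>i<k. k - i) + (\<Sum>i<k. excess \<gamma> i)"
  using sum_take_excess[OF assms order_refl] assms by (simp add: Dis_parts_def Dis_def)

lemma majorizes_iff_excess:
  assumes "\<gamma> \<in> Dis_parts k n" "\<delta> \<in> Dis_parts k n"
  shows "\<delta> \<succeq> \<gamma> \<longleftrightarrow> (\<forall>m\<le>k. (\<Sum>i<m. excess \<gamma> i) \<le> (\<Sum>i<m. excess \<delta> i))"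
proof -
  have "length \<gamma> = k" "length \<delta> = k" using assms by (auto simp: Dis_parts_def)
  then show ?thesis
    using sum_take_excess[OF assms(1)] sum_take_excess[OF assms(2)]
    by (auto simp: majorizes_def)
qed

lemma partition_of_excess_in_Dis:
  assumes "\<And>i j. i \<le> j \<Longrightarrow> j < k \<Longrightarrow> f j \<le> f i"
    and "n = (\<Sum>i<k. k - i) + (\<Sum>i<k. f i)"
  shows "partition_of_excess k f \<in> Dis_parts k n"
proof -
  have "sum_list (partition_of_excess k f) = n"
    using assms(2) sum.distrib[of "\<lambda>i. k - i" f "{..<k}"]
    by (simp add: partition_of_excess_def interv_sum_list_conv_sum_set_nat atLeast0LessThan)
  moreover have "sorted_wrt (>) (partition_of_excess k f)"
  proof -
    have "k - j + f j < k - i + f i" if "i < j" "j < k" for i j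
      using assms(1)[of i j] that by linarith
    then show ?thesis
      by (auto simp: partition_of_excess_def sorted_wrt_iff_nth_less)
  qed
  ultimately show ?thesis
    by (auto simp: Dis_parts_def Dis_def partition_of_excess_def)
qed

lemma excess_partition_of_excess:
  "i < k \<Longrightarrow> excess (partition_of_excess k f) i = f i"
  by (simp add: excess_def partition_of_excess_def)


section \<open>Majorization and blocks of partitions of equal length\<close>

lemma majorizes_refl: "\<gamma> \<succeq> \<gamma>"
  by (simp add: majorizes_def)

lemma majorizes_antisym:
  assumes "\<gamma> \<succeq> \<delta>" "\<delta> \<succeq> \<gamma>" "length \<gamma> = k" "length \<delta> = k"
  shows "\<gamma> = \<delta>"
proof (rule nth_equalityI)
  have eq: "sum_list (take m \<gamma>) = sum_list (take m \<delta>)" if "m \<le> k" for m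
    using assms that unfolding majorizes_def by (metis min.idem order_antisym)
  fix i assume "i < length \<gamma>"
  then show "\<gamma> ! i = \<delta> ! i"
    using assms(3,4) eq[of i] eq[of "Suc i"] by (simp add: take_Suc_conv_app_nth)
qed (use assms in simp)

text \<open>
  The partial sum of \<open>\<gamma>\<close> over all its parts is \<open>n\<close>, and no proper partial sum of \<open>\<delta>\<close> reaches \<open>n\<close>
  since its parts are positive. This is how majorization between partitions of different lengths
  carries information although it compares only the common initial segment.
\<close>

lemma majorizes_length:
  assumes "\<gamma> \<in> Dis n" "\<delta> \<in> Dis n" "\<delta> \<succeq> \<gamma>"
  shows "length \<delta> \<le> length \<gamma>"
proof (rule ccontr)
  assume "\<not> ?thesis"
  then have less: "length \<gamma> < length \<delta>" by simp
  have "n \<le> sum_list (take (length \<gamma>) \<delta>)"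
    using assms less by (auto simp: majorizes_def Dis_def dest: spec[of _ "length \<gamma>"])
  moreover have "sum_list (take (length \<gamma>) \<delta>) + sum_list (drop (length \<gamma>) \<delta>) = n"
    using assms(2) unfolding Dis_def
    by (metis (mono_tags, lifting) append_take_drop_id mem_Collect_eq sum_list_append)
  ultimately have "sum_list (drop (length \<gamma>) \<delta>) = 0" by linarith
  moreover have "\<delta> ! length \<gamma> \<in> set (drop (length \<gamma>) \<delta>)"
    using less by (metis Cons_nth_drop_Suc list.set_intros(1))
  moreover have "\<delta> ! length \<gamma> > 0"
    using less assms(2) by (auto simp: Dis_def)
  ultimately show False by (auto simp: sum_list_eq_0_iff)
qed

text \<open>
  The last part is \<open>n\<close> minus the sum of the others, so majorization reverses the order of the last
  parts.
\<close>

lemma majorizes_last: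
  assumes "\<gamma> \<in> Dis_parts k n" "\<delta> \<in> Dis_parts k n" "\<delta> \<succeq> \<gamma>" "0 < k"
  shows "last \<delta> \<le> last \<gamma>"
proof -
  have split: "sum_list (take (k - 1) \<epsilon>) + last \<epsilon> = n" if "\<epsilon> \<in> Dis_parts k n" for \<epsilon>
  proof -
    have "\<epsilon> \<noteq> []" using that assms(4) by (auto simp: Dis_parts_def)
    moreover have "length \<epsilon> = k" using that by (simp add: Dis_parts_def)
    ultimately have "\<epsilon> = take (k - 1) \<epsilon> @ [last \<epsilon>]"
      by (metis append_butlast_last_id butlast_conv_take)
    then have "sum_list \<epsilon> = sum_list (take (k - 1) \<epsilon>) + last \<epsilon>"
      by (metis add.right_neutral sum_list.Cons sum_list.Nil sum_list_append)
    then show ?thesis using that by (simp add: Dis_parts_def Dis_def)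
  qed
  have "sum_list (take (k - 1) \<gamma>) \<le> sum_list (take (k - 1) \<delta>)"
    using assms by (auto simp: majorizes_def Dis_parts_def)
  then show ?thesis using split[OF assms(1)] split[OF assms(2)] by linarith
qed

lemma last_pos:
  assumes "\<gamma> \<in> Dis_parts k n" "0 < k"
  shows "0 < last \<gamma>"
proof -
  have "\<gamma> \<noteq> []" using assms by (auto simp: Dis_parts_def)
  then have "last \<gamma> \<in> set \<gamma>" by simp
  then show ?thesis using assms(1) by (auto simp: Dis_parts_def Dis_def)
qed

lemma A_blocks_iff:
  "(\<alpha>, \<beta>) \<in> A_blocks n k \<longleftrightarrow> \<alpha> \<in> Dis_parts k n \<and> \<beta> \<in> Dis_parts k n \<and> \<beta> \<succeq> \<alpha>"
  by (auto simp: A_blocks_def S_Block_def Dis_parts_def)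

text \<open>
  Going up in the order of blocks can only shorten the left partition and lengthen the right one,
  whereas in an S-block the left partition is never the shorter one. Starting from equal lengths there is
  no room to move.
\<close>

lemma A_blocks_upward_closed:
  assumes "x \<in> A_blocks n k" "p \<in> S_Block n" "p \<succeq>\<^sub>S x"
  shows "p \<in> A_blocks n k"
proof -
  obtain \<alpha> \<beta> where p: "p = (\<alpha>, \<beta>)" by fastforce
  have x: "fst x \<in> Dis n" "snd x \<in> Dis n" "length (fst x) = k" "length (snd x) = k"
    using assms(1) by (auto simp: A_blocks_def Dis_parts_def)
  have Dis: "\<alpha> \<in> Dis n" "\<beta> \<in> Dis n" "\<beta> \<succeq> \<alpha>"
    using assms(2) p by (auto simp: S_Block_def)
  have "length \<alpha> \<le> k" "k \<le> length \<beta>" "length \<beta> \<le> length \<alpha>"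
    using majorizes_length[OF x(1) Dis(1)] majorizes_length[OF Dis(2) x(2)]
      majorizes_length[OF Dis] x assms(3) p by (auto simp: block_majorizes_def)
  then show ?thesis using Dis p by (auto simp: A_blocks_iff Dis_parts_def)
qed


section \<open>Least blocks and amphoras\<close>

text \<open>
  After removal of the staircase, the least element spreads the excess as evenly as possible, and
  the greatest one puts all of it on the first part.
\<close>

lemma Dis_parts_least_greatest:
  assumes "\<epsilon> \<in> Dis_parts k n"
  obtains \<mu> \<nu> where "\<mu> \<in> Dis_parts k n" "\<nu> \<in> Dis_parts k n"
    "\<And>\<gamma>. \<gamma> \<in> Dis_parts k n \<Longrightarrow> \<gamma> \<succeq> \<mu>" "\<And>\<gamma>. \<gamma> \<in> Dis_parts k n \<Longrightarrow> \<nu> \<succeq> \<gamma>"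
proof -
  define N where "N = (\<Sum>i<k. excess \<epsilon> i)"
  have n: "n = (\<Sum>i<k. k - i) + N" using sum_excess[OF assms] by (simp add: N_def)
  have sum_N: "(\<Sum>i<k. excess \<gamma> i) = N" if "\<gamma> \<in> Dis_parts k n" for \<gamma>
    using sum_excess[OF that] n by simp
  define f where "f = (\<lambda>i. N div k + (if i < N mod k then 1 else 0))"
  define g where "g = (\<lambda>i::nat. if i = 0 then N else 0)"
  have N0: "N = 0" if "k = 0" using that by (simp add: N_def)
  have sum_f: "(\<Sum>i<k. f i) = N"
  proof (cases "k = 0")
    case False
    then have "{..<k} \<inter> {i. i < N mod k} = {..<N mod k}"
      using less_trans[of _ "N mod k" k] by auto
    then have "(\<Sum>i<k. f i) = k * (N div k) + N mod k"
      by (simp add: f_def sum.distrib sum.If_cases)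
    then show ?thesis by simp
  qed (simp add: N0)
  have sum_g: "(\<Sum>i<m. g i) = N" if "0 < m" for m
    using that by (simp add: g_def)
  have sum_g_k: "(\<Sum>i<k. g i) = N"
    using sum_g[of k] N0 by (cases "k = 0") auto
  let ?\<mu> = "partition_of_excess k f" and ?\<nu> = "partition_of_excess k g"
  have \<mu>: "?\<mu> \<in> Dis_parts k n"
    using n sum_f by (intro partition_of_excess_in_Dis) (auto simp: f_def)
  have \<nu>: "?\<nu> \<in> Dis_parts k n"
    using n sum_g_k by (intro partition_of_excess_in_Dis) (auto simp: g_def)
  \<comment> \<open>At the first partial sum where \<open>\<gamma>\<close> falls short, its current excess is at most the quotient
    \<open>N div k\<close>; by monotonicity \<open>\<gamma>\<close> stays below the even distribution from there on and cannot
    reach the total.\<close>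
  have "\<gamma> \<succeq> ?\<mu>" if \<gamma>: "\<gamma> \<in> Dis_parts k n" for \<gamma>
  proof (rule ccontr)
    let ?e = "excess \<gamma>"
    assume "\<not> ?thesis"
    then obtain m where "m \<le> k" "(\<Sum>i<m. ?e i) < (\<Sum>i<m. excess ?\<mu> i)"
      using majorizes_iff_excess[OF \<mu> \<gamma>] by (auto simp: not_le)
    moreover from this have "(\<Sum>i<m. excess ?\<mu> i) = (\<Sum>i<m. f i)"
      by (intro sum.cong) (auto simp: excess_partition_of_excess)
    ultimately have "\<exists>m. m \<le> k \<and> (\<Sum>i<m. ?e i) < (\<Sum>i<m. f i)"
      by auto
    then obtain m where m: "m \<le> k" "(\<Sum>i<m. ?e i) < (\<Sum>i<m. f i)"
      and least: "\<And>l. l < m \<Longrightarrow> \<not> (l \<le> k \<and> (\<Sum>i<l. ?e i) < (\<Sum>i<l. f i))"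
      using exists_least_iff[of "\<lambda>m. m \<le> k \<and> (\<Sum>i<m. ?e i) < (\<Sum>i<m. f i)"] by blast
    obtain l where l: "m = Suc l" using m(2) by (cases m) auto
    have "?e l < f l" using least[of l] m l by auto
    then have "?e l \<le> N div k" by (auto simp: f_def split: if_splits)
    then have tail: "?e i \<le> f i" if "m \<le> i" "i < k" for i
      using excess_antimono[OF \<gamma>, of l i] that l by (simp add: f_def)
    have "N = (\<Sum>i<m. ?e i) + (\<Sum>i=m..<k. ?e i)"
      using sum_N[OF \<gamma>] sum.atLeastLessThan_concat[of 0 m k ?e] m(1) by (simp add: atLeast0LessThan)
    also have "\<dots> < (\<Sum>i<m. f i) + (\<Sum>i=m..<k. f i)"
      using m(2) tail by (intro add_less_le_mono sum_mono) auto
    also have "\<dots> = N"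
      using sum_f sum.atLeastLessThan_concat[of 0 m k f] m(1) by (simp add: atLeast0LessThan)
    finally show False by simp
  qed
  moreover have "?\<nu> \<succeq> \<gamma>" if \<gamma>: "\<gamma> \<in> Dis_parts k n" for \<gamma>
  proof -
    have "(\<Sum>i<m. excess \<gamma> i) \<le> (\<Sum>i<m. excess ?\<nu> i)" if "m \<le> k" for m
    proof (cases "m = 0")
      case False
      have "(\<Sum>i<m. excess \<gamma> i) \<le> (\<Sum>i<k. excess \<gamma> i)"
        using that by (intro sum_mono2) auto
      also have "\<dots> = (\<Sum>i<m. g i)" using sum_N[OF \<gamma>] sum_g[of m] False by simp
      also have "\<dots> = (\<Sum>i<m. excess ?\<nu> i)"
        using that by (intro sum.cong) (auto simp: excess_partition_of_excess)
      finally show ?thesis .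
    qed simp
    then show ?thesis using majorizes_iff_excess[OF \<gamma> \<nu>] by blast
  qed
  ultimately show thesis using that \<mu> \<nu> by blast
qed

lemma A_blocks_least:
  assumes "A_blocks n k \<noteq> {}"
  obtains x where "x \<in> A_blocks n k" "\<And>p. p \<in> A_blocks n k \<Longrightarrow> p \<succeq>\<^sub>S x"
proof -
  obtain \<alpha> \<beta> where "(\<alpha>, \<beta>) \<in> A_blocks n k" using assms by auto
  then have "\<alpha> \<in> Dis_parts k n" by (simp add: A_blocks_iff)
  then obtain \<mu> \<nu> where "\<mu> \<in> Dis_parts k n" "\<nu> \<in> Dis_parts k n"
    "\<And>\<gamma>. \<gamma> \<in> Dis_parts k n \<Longrightarrow> \<gamma> \<succeq> \<mu>" "\<And>\<gamma>. \<gamma> \<in> Dis_parts k n \<Longrightarrow> \<nu> \<succeq> \<gamma>"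
    by (rule Dis_parts_least_greatest) blast
  then show thesis
    by (intro that[of "(\<mu>, \<nu>)"]) (auto simp: A_blocks_iff block_majorizes_def)
qed

lemma S_Block_nonempty: "S_Block n \<noteq> {}"
proof -
  have "(if n = 0 then ([], []) else ([n], [n])) \<in> S_Block n"
    by (simp add: S_Block_def Dis_def majorizes_def)
  then show ?thesis by blast
qed

text \<open>
  The antichain is the set of blocks \<open>[\<gamma>|\<gamma>]\<close> in \<open>Q\<close>. Two of them are comparable only if they
  majorize each other both ways, hence are equal; and \<open>[\<alpha>|\<beta>]\<close> always lies below \<open>[\<alpha>|\<alpha>]\<close>.
  The convexity condition has to be checked only among blocks of \<open>A(n, k)\<close>, because this set is
  upward closed.
\<close>

lemma amphora_in_S_Block:
  assumes sub: "Q \<subseteq> A_blocks n k"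
    and least: "Q \<noteq> {} \<Longrightarrow> \<exists>x\<in>Q. \<forall>p\<in>Q. p \<succeq>\<^sub>S x"
    and diag: "\<And>\<alpha> \<beta>. (\<alpha>, \<beta>) \<in> Q \<Longrightarrow> (\<alpha>, \<alpha>) \<in> Q"
    and convex: "\<And>x p a. x \<in> Q \<Longrightarrow> a \<in> Q \<Longrightarrow> p \<in> A_blocks n k \<Longrightarrow>
      p \<succeq>\<^sub>S x \<Longrightarrow> a \<succeq>\<^sub>S p \<Longrightarrow> p \<in> Q"
  shows "amphora_in (S_Block n) (\<succeq>\<^sub>S) Q"
proof (cases "Q = {}")
  case True
  then show ?thesis
    using S_Block_nonempty[of n] unfolding amphora_in_def antichain_in_def by blast
next
  case False
  then obtain x where x: "x \<in> Q" "\<And>p. p \<in> Q \<Longrightarrow> p \<succeq>\<^sub>S x" using least by blast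
  let ?A = "{(\<gamma>, \<gamma>) | \<gamma>. (\<gamma>, \<gamma>) \<in> Q}"
  have S: "A_blocks n k \<subseteq> S_Block n" by (auto simp: A_blocks_def)
  have len: "length \<alpha> = k \<and> length \<beta> = k \<and> \<beta> \<succeq> \<alpha>" if "(\<alpha>, \<beta>) \<in> Q" for \<alpha> \<beta>
    using that sub by (auto simp: A_blocks_iff Dis_parts_def)
  have "antichain_in (S_Block n) (\<succeq>\<^sub>S) ?A"
    using sub S len by (auto simp: antichain_in_def block_majorizes_def dest: majorizes_antisym)
  moreover have "Q = {p \<in> S_Block n. p \<succeq>\<^sub>S x \<and> (\<exists>a\<in>?A. a \<succeq>\<^sub>S p)}"
  proof (intro equalityI subsetI)
    fix p assume p: "p \<in> Q"
    obtain \<alpha> \<beta> where ab: "p = (\<alpha>, \<beta>)" by fastforce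
    have "(\<alpha>, \<alpha>) \<in> ?A" "(\<alpha>, \<alpha>) \<succeq>\<^sub>S p"
      using p ab diag len by (auto simp: block_majorizes_def majorizes_refl)
    then show "p \<in> {p \<in> S_Block n. p \<succeq>\<^sub>S x \<and> (\<exists>a\<in>?A. a \<succeq>\<^sub>S p)}"
      using p x(2) sub S by blast
  next
    fix p assume "p \<in> {p \<in> S_Block n. p \<succeq>\<^sub>S x \<and> (\<exists>a\<in>?A. a \<succeq>\<^sub>S p)}"
    then show "p \<in> Q"
      using convex x(1) sub A_blocks_upward_closed by blast
  qed
  ultimately show ?thesis
    using x sub S unfolding amphora_in_def by blast
qed

lemma amphora_A_blocks: "amphora_in (S_Block n) (\<succeq>\<^sub>S) (A_blocks n k)"
proof (rule amphora_in_S_Block[OF order_refl])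
  show "\<exists>x\<in>A_blocks n k. \<forall>p\<in>A_blocks n k. p \<succeq>\<^sub>S x" if "A_blocks n k \<noteq> {}"
    using A_blocks_least[OF that] by metis
qed (auto simp: A_blocks_iff majorizes_refl)


section \<open>Raising every part by one\<close>

lemma majorization_bijection_inv:
  assumes "majorization_bijection \<phi> P Q"
  shows "majorization_bijection (inv_into P \<phi>) Q P"
proof -
  have bij: "bij_betw \<phi> P Q" using assms by (simp add: majorization_bijection_def)
  have "x \<succeq>\<^sub>S y \<longleftrightarrow> inv_into P \<phi> x \<succeq>\<^sub>S inv_into P \<phi> y" if "x \<in> Q" "y \<in> Q" for x y
    using assms that bij_betw_inv_into_right[OF bij] bij_betwE[OF bij_betw_inv_into[OF bij]]
    by (metis majorization_bijection_def)
  then show ?thesis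
    using bij_betw_inv_into[OF bij] by (simp add: majorization_bijection_def)
qed

text \<open>
  Least elements are transported along order isomorphisms, which provides the bottom of the
  amphoras of starred NG-blocks without computing it.
\<close>

lemma majorization_bijection_least:
  assumes "majorization_bijection \<phi> (A_blocks n k) Q" "Q \<noteq> {}"
  shows "\<exists>x\<in>Q. \<forall>p\<in>Q. p \<succeq>\<^sub>S x"
proof -
  have img: "Q = \<phi> ` A_blocks n k"
    using assms(1) by (auto simp: majorization_bijection_def bij_betw_def)
  then have "A_blocks n k \<noteq> {}" using assms(2) by blast
  then obtain x where x: "x \<in> A_blocks n k" "\<And>p. p \<in> A_blocks n k \<Longrightarrow> p \<succeq>\<^sub>S x"
    by (rule A_blocks_least) blast
  then have "\<forall>p\<in>Q. p \<succeq>\<^sub>S \<phi> x"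
    using assms(1) img by (auto simp: majorization_bijection_def)
  then show ?thesis using x(1) img by blast
qed

lemma sum_list_map_Suc: "sum_list (map Suc xs) = sum_list xs + length xs"
  by (induction xs) auto

lemma sum_list_take_map_Suc:
  "m \<le> length xs \<Longrightarrow> sum_list (take m (map Suc xs)) = sum_list (take m xs) + m"
  by (simp add: take_map sum_list_map_Suc)

lemma map_Suc_majorizes:
  assumes "length \<gamma> = length \<delta>"
  shows "map Suc \<delta> \<succeq> map Suc \<gamma> \<longleftrightarrow> \<delta> \<succeq> \<gamma>"
  using assms by (auto simp: majorizes_def sum_list_take_map_Suc)

text \<open>
  The only new comparisons are those of the sums over all old parts and over everything, and these
  sums agree.
\<close>

lemma snoc_majorizes:
  assumes "length \<gamma> = length \<delta>" "sum_list \<gamma> = sum_list \<delta>"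
  shows "\<delta> @ [c] \<succeq> \<gamma> @ [c] \<longleftrightarrow> \<delta> \<succeq> \<gamma>"
  using assms by (auto simp: majorizes_def le_Suc_eq)

lemma Dis_parts_lowerI:
  assumes "\<gamma> \<in> Dis_parts k n" "\<And>g. g \<in> set \<gamma> \<Longrightarrow> 2 \<le> g"
  shows "map (\<lambda>g. g - 1) \<gamma> \<in> Dis_parts k (n - k)" "map Suc (map (\<lambda>g. g - 1) \<gamma>) = \<gamma>"
proof -
  show eq: "map Suc (map (\<lambda>g. g - 1) \<gamma>) = \<gamma>"
    using assms(2) by (force intro: map_idI)
  have "sum_list (map Suc (map (\<lambda>g. g - 1) \<gamma>)) = sum_list (map (\<lambda>g. g - 1) \<gamma>) + length \<gamma>"
    by (simp only: sum_list_map_Suc length_map)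
  then have "sum_list (map (\<lambda>g. g - 1) \<gamma>) = n - k"
    using assms(1) unfolding eq Dis_parts_def Dis_def by auto
  moreover have "sorted_wrt (>) (map (\<lambda>g. g - 1) \<gamma>)"
  proof -
    have "sorted_wrt (>) (map Suc (map (\<lambda>g. g - 1) \<gamma>))"
      unfolding eq using assms(1) by (simp add: Dis_parts_def Dis_def)
    then show ?thesis by (simp only: sorted_wrt_map Suc_less_eq)
  qed
  moreover have "0 < g" if "g \<in> set (map (\<lambda>g. g - 1) \<gamma>)" for g
    using assms(2) that by fastforce
  ultimately show "map (\<lambda>g. g - 1) \<gamma> \<in> Dis_parts k (n - k)"
    using assms(1) by (simp add: Dis_parts_def Dis_def)
qed

lemma Dis_parts_ge_last:
  assumes "\<gamma> \<in> Dis_parts k n" "g \<in> set \<gamma>"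
  shows "last \<gamma> \<le> g"
proof -
  obtain i where i: "i < length \<gamma>" "g = \<gamma> ! i" using assms(2) by (metis in_set_conv_nth)
  have "\<gamma> ! (length \<gamma> - 1) + (length \<gamma> - 1 - i) \<le> \<gamma> ! i"
    using assms i by (intro Dis_gap) (auto simp: Dis_def Dis_parts_def)
  then show ?thesis using i by (cases "\<gamma> = []") (auto simp: last_conv_nth)
qed

lemma Dis_parts_raise:
  assumes "\<gamma> \<in> Dis_parts k (n - k)" "k \<le> n"
  shows "map Suc \<gamma> \<in> Dis_parts k n"
  using assms by (auto simp: Dis_parts_def Dis_def sorted_wrt_map sum_list_map_Suc)

lemma Dis_parts_raise_snoc:
  assumes "\<gamma> \<in> Dis_parts k (n - Suc k)" "Suc k \<le> n"
  shows "map Suc \<gamma> @ [1] \<in> Dis_parts (Suc k) n"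
  using assms by (auto simp: Dis_parts_def Dis_def sorted_wrt_map sorted_wrt_append sum_list_map_Suc)

lemma ex_raise:
  assumes "\<gamma> \<in> Dis_parts k n" "2 \<le> last \<gamma>"
  shows "\<exists>\<gamma>'\<in>Dis_parts k (n - k). \<gamma> = map Suc \<gamma>'"
proof -
  have "2 \<le> g" if "g \<in> set \<gamma>" for g
    using Dis_parts_ge_last[OF assms(1) that] assms(2) by simp
  from Dis_parts_lowerI[OF assms(1) this] show ?thesis by force
qed

lemma ex_raise_snoc:
  assumes "\<gamma> \<in> Dis_parts (Suc k) n" "last \<gamma> = 1"
  shows "\<exists>\<gamma>'\<in>Dis_parts k (n - Suc k). \<gamma> = map Suc \<gamma>' @ [1]"
proof -
  define \<delta> where "\<delta> = butlast \<gamma>"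
  have \<gamma>: "\<gamma> = \<delta> @ [1]"
    using assms append_butlast_last_id[of \<gamma>] by (cases \<gamma>) (auto simp: \<delta>_def Dis_parts_def)
  have "\<delta> \<in> Dis_parts k (n - 1)" and "\<And>g. g \<in> set \<delta> \<Longrightarrow> 2 \<le> g"
    using assms(1) \<gamma> by (auto simp: Dis_parts_def Dis_def sorted_wrt_append)
  then have "map (\<lambda>g. g - 1) \<delta> \<in> Dis_parts k (n - Suc k)"
    "\<gamma> = map Suc (map (\<lambda>g. g - 1) \<delta>) @ [1]"
    using Dis_parts_lowerI[of \<delta> k "n - 1"] \<gamma> by auto
  then show ?thesis by blast
qed

text \<open>
  Adding 1 to each of \<open>k\<close> parts shifts the \<open>m\<close>-th partial sum by \<open>m\<close> on both sides of every
  comparison. The partitions reached this way are those without a part equal to 1.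
\<close>

lemma bijection_raise:
  assumes "k \<le> n" "0 < k"
  shows "majorization_bijection (\<lambda>(\<alpha>, \<beta>). (map Suc \<alpha>, map Suc \<beta>)) (A_blocks (n - k) k)
    {b \<in> A_blocks n k. 2 \<le> last (fst b) \<and> 2 \<le> last (snd b)}" (is "majorization_bijection ?f ?P ?Q")
proof -
  have "?f ` ?P \<subseteq> ?Q"
  proof
    fix b assume "b \<in> ?f ` ?P"
    then obtain \<alpha> \<beta> where "(\<alpha>, \<beta>) \<in> ?P" "b = (map Suc \<alpha>, map Suc \<beta>)" by auto
    moreover from this have "\<alpha> \<noteq> []" "\<beta> \<noteq> []" "length \<alpha> = length \<beta>"
      using assms(2) by (auto simp: A_blocks_iff Dis_parts_def)
    moreover from calculation have "0 < last \<alpha>" "0 < last \<beta>"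
      using last_pos assms(2) by (auto simp: A_blocks_iff)
    ultimately show "b \<in> ?Q"
      using assms by (auto simp: A_blocks_iff map_Suc_majorizes last_map intro: Dis_parts_raise)
  qed
  moreover have "?Q \<subseteq> ?f ` ?P"
  proof
    fix b assume b: "b \<in> ?Q"
    then have "fst b \<in> Dis_parts k n" "snd b \<in> Dis_parts k n"
      by (auto simp: A_blocks_def)
    then obtain \<alpha> \<beta> where "\<alpha> \<in> Dis_parts k (n - k)" "\<beta> \<in> Dis_parts k (n - k)"
      and "fst b = map Suc \<alpha>" "snd b = map Suc \<beta>"
      using b ex_raise by blast
    moreover from this have eq: "b = (map Suc \<alpha>, map Suc \<beta>)"
      by (simp add: prod_eq_iff)
    moreover from calculation have "length \<alpha> = length \<beta>" by (simp add: Dis_parts_def)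
    ultimately have "(\<alpha>, \<beta>) \<in> ?P"
      using b by (auto simp: A_blocks_iff map_Suc_majorizes)
    then show "b \<in> ?f ` ?P" using eq by force
  qed
  moreover have "inj_on ?f ?P" by (auto simp: inj_on_def)
  moreover have "x \<succeq>\<^sub>S y \<longleftrightarrow> ?f x \<succeq>\<^sub>S ?f y" if "x \<in> ?P" "y \<in> ?P" for x y
    using that by (cases x; cases y)
      (auto simp: block_majorizes_def A_blocks_iff Dis_parts_def map_Suc_majorizes)
  ultimately show ?thesis
    unfolding majorization_bijection_def bij_betw_def by blast
qed

text \<open>
  The companion of the previous map for partitions whose smallest part is 1: that part corresponds
  to a part 0, which is absent from the smaller partition.
\<close>

lemma bijection_raise_snoc:
  assumes "Suc k \<le> n"
  shows "majorization_bijection (\<lambda>(\<alpha>, \<beta>). (map Suc \<alpha> @ [1], map Suc \<beta> @ [1]))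
    (A_blocks (n - Suc k) k)
    {b \<in> A_blocks n (Suc k). last (fst b) = 1 \<and> last (snd b) = 1}"
    (is "majorization_bijection ?f ?P ?Q")
proof -
  have maj: "map Suc \<delta> @ [1] \<succeq> map Suc \<gamma> @ [1] \<longleftrightarrow> \<delta> \<succeq> \<gamma>"
    if "\<gamma> \<in> Dis_parts k (n - Suc k)" "\<delta> \<in> Dis_parts k (n - Suc k)" for \<gamma> \<delta>
    using that by (simp add: snoc_majorizes map_Suc_majorizes Dis_parts_def Dis_def sum_list_map_Suc)
  have "?f ` ?P \<subseteq> ?Q"
    using assms Dis_parts_raise_snoc[of _ k n] by (auto simp: A_blocks_iff maj[simplified])
  moreover have "?Q \<subseteq> ?f ` ?P"
  proof
    fix b assume b: "b \<in> ?Q"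
    then have "fst b \<in> Dis_parts (Suc k) n" "snd b \<in> Dis_parts (Suc k) n"
      by (auto simp: A_blocks_def)
    then obtain \<alpha> \<beta> where ab: "\<alpha> \<in> Dis_parts k (n - Suc k)" "\<beta> \<in> Dis_parts k (n - Suc k)"
      and "fst b = map Suc \<alpha> @ [1]" "snd b = map Suc \<beta> @ [1]"
      using b ex_raise_snoc by blast
    then have eq: "b = (map Suc \<alpha> @ [1], map Suc \<beta> @ [1])"
      by (simp add: prod_eq_iff)
    then have "(\<alpha>, \<beta>) \<in> ?P"
      using b maj[OF ab] ab by (simp add: A_blocks_iff)
    then show "b \<in> ?f ` ?P" using eq by force
  qed
  moreover have "inj_on ?f ?P" by (auto simp: inj_on_def)
  moreover have "x \<succeq>\<^sub>S y \<longleftrightarrow> ?f x \<succeq>\<^sub>S ?f y" if "x \<in> ?P" "y \<in> ?P" for x y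
    using that by (cases x; cases y)
      (auto simp: block_majorizes_def A_blocks_iff maj[simplified])
  ultimately show ?thesis
    unfolding majorization_bijection_def bij_betw_def by blast
qed


section \<open>Chromatic numbers of split graphs\<close>

lemma vdeg_eq_card_nbrs:
  assumes "simple_graph V E"
  shows "vdeg E v = card {u \<in> V. {v, u} \<in> E}"
proof -
  have "bij_betw (\<lambda>u. {v, u}) {u \<in> V. {v, u} \<in> E} {e \<in> E. v \<in> e}"
  proof (rule bij_betw_imageI)
    show "inj_on (\<lambda>u. {v, u}) {u \<in> V. {v, u} \<in> E}"
      by (auto simp: inj_on_def doubleton_eq_iff)
    show "(\<lambda>u. {v, u}) ` {u \<in> V. {v, u} \<in> E} = {e \<in> E. v \<in> e}"
    proof (intro equalityI subsetI)
      fix e assume e: "e \<in> {e \<in> E. v \<in> e}"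
      then have "e \<in> [V]\<^bsup>2\<^esup>" using assms by (auto simp: simple_graph_def)
      then obtain x y where "e = {x, y}" "x \<in> V" "y \<in> V" by (auto elim: nsets2_E)
      then show "e \<in> (\<lambda>u. {v, u}) ` {u \<in> V. {v, u} \<in> E}"
        using e by (auto simp: insert_commute)
    qed auto
  qed
  then show ?thesis by (simp add: vdeg_def bij_betw_same_card)
qed

lemma edge_distinct: "simple_graph V E \<Longrightarrow> {u, v} \<in> E \<Longrightarrow> u \<noteq> v"
  by (auto simp: simple_graph_def nsets_def)

lemma chromatic_number_eq_clique:
  assumes "finite V" "proper_coloring V E (card K) f" "K \<subseteq> V" "clique K E"
  shows "chromatic_number V E = card K"
  unfolding chromatic_number_def
proof (rule Least_equality)
  show "\<exists>f. proper_coloring V E (card K) f" using assms(2) by blast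
  fix c assume "\<exists>f. proper_coloring V E c f"
  then obtain g where g: "proper_coloring V E c g" by blast
  have "inj_on g K"
    using g assms(3,4) unfolding inj_on_def clique_def proper_coloring_def by blast
  moreover have "g ` K \<subseteq> {..<c}" using g assms(3) by (auto simp: proper_coloring_def)
  ultimately show "card K \<le> c"
    using card_inj_on_le[of g K "{..<c}"] by simp
qed

text \<open>
  For a split graph in which some vertex \<open>r\<close> of the stable side sees the whole clique \<open>T\<close>, colourings
  are matched by cliques: \<open>T\<close> with \<open>r\<close> in the graph, the stable set in the complement. In the
  complement all of \<open>T\<close> may share the colour of \<open>r\<close>.
\<close>

lemma chromatic_numbers_split:
  assumes G: "simple_graph V E"
    and T: "T \<subseteq> V" "r \<in> V - T" "clique (insert r T) E" "indep (V - T) E"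
  shows "chromatic_number V E = card T + 1"
    and "chromatic_number V ([V]\<^bsup>2\<^esup> - E) = card V - card T"
proof -
  have fin: "finite V" using G by (simp add: simple_graph_def)
  then have finT: "finite T" using T(1) finite_subset by blast
  have card_R: "card (V - T) = card V - card T"
    using card_Diff_subset[OF finT T(1)] .
  \<comment> \<open>The clique gets distinct colours, the stable set one further colour.\<close>
  obtain h where h: "bij_betw h T {0..<card T}"
    using ex_bij_betw_finite_nat[OF finT] by blast
  have "proper_coloring V E (card T + 1) (\<lambda>v. if v \<in> T then h v else card T)"
    (is "proper_coloring _ _ _ ?f")
  proof -
    have less: "h v < card T" if "v \<in> T" for v using bij_betwE[OF h] that by auto
    have "?f u \<noteq> ?f v" if "u \<in> V" "v \<in> V" "{u, v} \<in> E" for u v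
    proof -
      have "u \<noteq> v" "\<not> (u \<in> V - T \<and> v \<in> V - T)"
        using that(3) edge_distinct[OF G] T(4) unfolding indep_def by blast+
      moreover from this have "h u \<noteq> h v" if "u \<in> T" "v \<in> T"
        using bij_betw_imp_inj_on[OF h] that unfolding inj_on_def by blast
      ultimately show ?thesis using less[of u] less[of v] that(1,2) by auto
    qed
    moreover have "?f ` V \<subseteq> {..<card T + 1}" using less by (auto simp: less_Suc_eq)
    ultimately show ?thesis by (simp add: proper_coloring_def)
  qed
  moreover have "card (insert r T) = card T + 1" using T(2) finT by simp
  ultimately show "chromatic_number V E = card T + 1"
    using chromatic_number_eq_clique[of V E "insert r T"] fin T by auto
  \<comment> \<open>In the complement \<open>r\<close> is isolated from \<open>T\<close>, and \<open>T\<close> is stable.\<close>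
  obtain h where h: "bij_betw h (V - T) {0..<card (V - T)}"
    using ex_bij_betw_finite_nat[of "V - T"] fin by blast
  have "proper_coloring V ([V]\<^bsup>2\<^esup> - E) (card (V - T)) (\<lambda>v. if v \<in> T then h r else h v)"
    (is "proper_coloring _ _ _ ?f")
  proof -
    let ?g = "\<lambda>v. if v \<in> T then r else v"
    have g: "?g v \<in> V - T" if "v \<in> V" for v using that T(2) by simp
    have f: "?f v = h (?g v)" for v by simp
    have "?f u \<noteq> ?f v" if "u \<in> V" "v \<in> V" "{u, v} \<in> [V]\<^bsup>2\<^esup> - E" for u v
    proof
      assume "?f u = ?f v"
      then have "?g u = ?g v"
        using bij_betw_imp_inj_on[OF h] g[OF that(1)] g[OF that(2)] unfolding f inj_on_def by blast
      then have "u = v \<or> (u \<in> insert r T \<and> v \<in> insert r T)" by (auto split: if_splits)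
      then show False using T(3) that(3) by (auto simp: clique_def)
    qed
    moreover have "?f ` V \<subseteq> {..<card (V - T)}"
      using bij_betwE[OF h] g unfolding f by fastforce
    ultimately show ?thesis unfolding proper_coloring_def by blast
  qed
  moreover have "clique (V - T) ([V]\<^bsup>2\<^esup> - E)"
    using T(4) by (auto simp: clique_def indep_def)
  ultimately show "chromatic_number V ([V]\<^bsup>2\<^esup> - E) = card V - card T"
    using chromatic_number_eq_clique[OF fin] unfolding card_R[symmetric] by blast
qed

text \<open>
  The two chromatic numbers add up to \<open>|V| + 1\<close>, so such a graph is always an NG-graph, and its
  distinguished vertices are those of degree \<open>|T|\<close>. The vertex \<open>r\<close> is one of them. It is adjacent to
  all of \<open>T\<close> and to nothing else: a clique of distinguished vertices cannot contain another vertex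
  outside \<open>T\<close>, and a stable set of them contains no vertex of \<open>T\<close>.
\<close>

lemma NG_kind_split:
  assumes G: "simple_graph V E" "no_isolated_vertices V E"
    and T: "T \<subseteq> V" "r \<in> V - T" "clique (insert r T) E" "indep (V - T) E"
  shows "NG1_graph V E \<longleftrightarrow> card {v \<in> V - T. vdeg E v = card T} = 1"
    and "NG2_graph V E \<longleftrightarrow> (\<forall>v\<in>T. card T < vdeg E v)"
proof -
  note deg = vdeg_eq_card_nbrs[OF G(1)]
  have fin: "finite V" using G by (simp add: simple_graph_def)
  have "card T \<le> card V" using card_mono[OF fin T(1)] .
  then have NG: "NG_graph V E"
    using G chromatic_numbers_split[OF G(1) T] by (simp add: NG_graph_def)
  have A: "A_vertices V E = {v \<in> V. vdeg E v = card T}"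
    using chromatic_numbers_split(1)[OF G(1) T] by (simp add: A_vertices_def)
  have "{r, u} \<in> E" if "u \<in> T" for u
    using T(2,3) that by (auto simp: clique_def)
  moreover have "{r, u} \<notin> E" if "u \<in> V - T" for u
    using T(2,4) edge_distinct[OF G(1), of r u] that by (auto simp: indep_def)
  ultimately have "{u \<in> V. {r, u} \<in> E} = T" using T(1) by blast
  then have deg_r: "vdeg E r = card T" by (simp add: deg)
  have deg_T: "card T \<le> vdeg E v" if "v \<in> T" for v
  proof -
    have "insert r (T - {v}) \<subseteq> {u \<in> V. {v, u} \<in> E}"
      using that T by (auto simp: clique_def)
    then have "card (insert r (T - {v})) \<le> vdeg E v"
      unfolding deg using fin by (intro card_mono) auto
    moreover have "card (insert r (T - {v})) = card T"
    proof -
      have "finite T" using finite_subset[OF T(1) fin] .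
      then show ?thesis
        using card_Suc_Diff1[of T v] that T(2) by (simp del: card_Diff_singleton card_Diff_insert)
    qed
    ultimately show ?thesis by simp
  qed
  let ?B = "{v \<in> V - T. vdeg E v = card T}"
  have r: "r \<in> ?B" using T(2) deg_r by simp
  show "NG1_graph V E \<longleftrightarrow> card ?B = 1"
  proof
    assume "NG1_graph V E"
    then have "clique ?B E" by (auto simp: NG1_graph_def A clique_def)
    then have "?B = {r}" using T(4) r unfolding clique_def indep_def by blast
    then show "card ?B = 1" by simp
  next
    assume "card ?B = 1"
    then have "?B = {r}" using r by (metis card_1_singletonE singletonD)
    then have "A_vertices V E \<subseteq> insert r T" by (auto simp: A)
    then show "NG1_graph V E" using NG T(3) by (simp add: NG1_graph_def smaller_clique)
  qed
  show "NG2_graph V E \<longleftrightarrow> (\<forall>v\<in>T. card T < vdeg E v)"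
  proof
    assume "NG2_graph V E"
    then have indep: "indep (A_vertices V E) E" by (simp add: NG2_graph_def)
    show "\<forall>v\<in>T. card T < vdeg E v"
    proof
      fix v assume v: "v \<in> T"
      then have "{v, r} \<in> E" "v \<noteq> r" using T(2,3) by (auto simp: clique_def)
      then have "v \<notin> A_vertices V E"
        using indep r by (auto simp: indep_def A)
      then show "card T < vdeg E v" using deg_T[OF v] v T(1) by (auto simp: A)
    qed
  next
    assume "\<forall>v\<in>T. card T < vdeg E v"
    then have "A_vertices V E \<subseteq> V - T" by (auto simp: A)
    then show "NG2_graph V E" using NG T(4) by (simp add: NG2_graph_def smaller_indep)
  qed
qed


section \<open>Blocks of degree sequences\<close>

lemma degree_sequence_eq:
  assumes "distinct vs" "set vs = V" "sorted_wrt (\<ge>) (map (vdeg E) vs)"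
  shows "degree_sequence V E = map (vdeg E) vs"
proof -
  have "sort (map (vdeg E) vs) = rev (map (vdeg E) vs)"
    using assms(3) by (intro properties_for_sort) (auto simp: sorted_wrt_rev)
  moreover have "image_mset (vdeg E) (mset_set V) = mset (map (vdeg E) vs)"
    using assms(1,2) by (auto simp flip: mset_set_set)
  ultimately show ?thesis
    by (simp only: degree_sequence_def sorted_list_of_multiset_mset rev_rev_ident)
qed

lemma ex_degree_ordering:
  assumes "finite V"
  obtains vs where "distinct vs" "set vs = V" "sorted_wrt (\<ge>) (map (vdeg E) vs)"
proof -
  obtain us where us: "set us = V" "distinct us" using finite_distinct_list[OF assms] by blast
  let ?vs = "rev (sort_key (vdeg E) us)"
  have "sorted_wrt (\<ge>) (map (vdeg E) ?vs)"
    by (simp add: rev_map[symmetric] sorted_wrt_rev)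
  then show thesis using that[of ?vs] us by simp
qed

text \<open>
  The \<open>j\<close>-th part, counted from 1, of the conjugate partition of \<open>\<pi>\<close>.
\<close>

definition conj_deg :: "nat list \<Rightarrow> nat \<Rightarrow> nat" where
  "conj_deg \<pi> j = card {i. i < length \<pi> \<and> j \<le> \<pi> ! i}"

text \<open>
  In a weakly decreasing sequence the indices that contribute a part form an initial segment, since
  the entries decrease while the bound \<open>i\<close> grows. Its length \<open>h\<close> is the side of the Durfee square.
\<close>

lemma alpha_part_eq:
  assumes "h \<le> length \<pi>" "\<And>i. i < h \<Longrightarrow> i < \<pi> ! i"
    and "\<And>i. h \<le> i \<Longrightarrow> i < length \<pi> \<Longrightarrow> \<pi> ! i \<le> i"
  shows "alpha_part \<pi> = map (\<lambda>i. \<pi> ! i - i) [0..<h]"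
proof -
  let ?f = "\<lambda>i. if i + 1 \<le> \<pi> ! i then [\<pi> ! i - i] else []"
  have "[0..<length \<pi>] = [0..<h] @ [h..<length \<pi>]"
    using assms(1) upt_add_eq_append[of 0 h "length \<pi> - h"] by simp
  then have "alpha_part \<pi> = concat (map ?f [0..<h]) @ concat (map ?f [h..<length \<pi>])"
    by (simp add: alpha_part_def)
  also have "map ?f [0..<h] = map (\<lambda>i. [\<pi> ! i - i]) [0..<h]"
    using assms(2) by (auto simp: Suc_le_eq)
  also have "concat (map ?f [h..<length \<pi>]) = []"
    using assms(3)[THEN leD] by (auto simp: Suc_le_eq)
  finally show ?thesis by (simp add: concat_map_singleton)
qed

lemma alpha_part_sorted:
  assumes "sorted_wrt (\<ge>) \<pi>"
  obtains h where "h \<le> length \<pi>" "\<And>i. i < h \<Longrightarrow> i < \<pi> ! i"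
    "\<And>i. h \<le> i \<Longrightarrow> i < length \<pi> \<Longrightarrow> \<pi> ! i \<le> i"
    "alpha_part \<pi> = map (\<lambda>i. \<pi> ! i - i) [0..<h]"
proof -
  define h where "h = (LEAST i. length \<pi> \<le> i \<or> \<pi> ! i \<le> i)"
  have h: "length \<pi> \<le> h \<or> \<pi> ! h \<le> h"
    unfolding h_def by (rule LeastI[of _ "length \<pi>"]) simp
  have "h \<le> length \<pi>" unfolding h_def by (rule Least_le) simp
  moreover have "i < \<pi> ! i" if "i < h" for i
    using not_less_Least[OF that[unfolded h_def]] by simp
  moreover have "\<pi> ! i \<le> i" if "h \<le> i" "i < length \<pi>" for i
  proof -
    have "\<pi> ! i \<le> \<pi> ! h"
      using assms that by (cases "h = i") (auto simp: sorted_wrt_iff_nth_less)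
    then show ?thesis using h that by simp
  qed
  ultimately show thesis using that alpha_part_eq by blast
qed

lemma conj_deg_antimono: "i \<le> j \<Longrightarrow> conj_deg \<pi> j \<le> conj_deg \<pi> i"
  unfolding conj_deg_def by (intro card_mono) auto

lemma conj_deg_le_length: "conj_deg \<pi> j \<le> length \<pi>"
  using card_mono[of "{..<length \<pi>}" "{i. i < length \<pi> \<and> j \<le> \<pi> ! i}"]
  by (auto simp: conj_deg_def)

lemma beta_part_eq:
  assumes "h \<le> length \<pi>" "\<And>j. 1 \<le> j \<Longrightarrow> j \<le> h \<Longrightarrow> j < conj_deg \<pi> j"
    and "\<And>j. h < j \<Longrightarrow> conj_deg \<pi> j \<le> j"
  shows "beta_part \<pi> = map (\<lambda>j. conj_deg \<pi> (Suc j) - Suc j) [0..<h]"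
proof -
  let ?f = "\<lambda>j. conj_deg \<pi> (Suc j) - Suc j"
  have "beta_part \<pi> = filter (\<lambda>p. 0 < p) (map (\<lambda>j. conj_deg \<pi> j - j) [1..<length \<pi> + 1])"
    by (simp add: beta_part_def conj_deg_def)
  also have "[1..<length \<pi> + 1] = map Suc [0..<length \<pi>]"
    by (simp add: map_Suc_upt)
  also have "[0..<length \<pi>] = [0..<h] @ [h..<length \<pi>]"
    using assms(1) upt_add_eq_append[of 0 h "length \<pi> - h"] by simp
  finally have "beta_part \<pi> = filter (\<lambda>p. 0 < p) (map ?f [0..<h])
      @ filter (\<lambda>p. 0 < p) (map ?f [h..<length \<pi>])"
    by (simp add: comp_def)
  also have "filter (\<lambda>p. 0 < p) (map ?f [0..<h]) = map ?f [0..<h]"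
    using assms(2)[of "Suc _"] by (auto simp: filter_id_conv)
  also have "filter (\<lambda>p. 0 < p) (map ?f [h..<length \<pi>]) = []"
    using assms(3)[of "Suc _"] by (auto simp: filter_empty_conv)
  finally show ?thesis by simp
qed

lemma beta_part_obtain:
  obtains h where "h \<le> length \<pi>" "\<And>j. 1 \<le> j \<Longrightarrow> j \<le> h \<Longrightarrow> j < conj_deg \<pi> j"
    "beta_part \<pi> = map (\<lambda>j. conj_deg \<pi> (Suc j) - Suc j) [0..<h]"
proof -
  define h where "h = (LEAST h. conj_deg \<pi> (Suc h) \<le> Suc h)"
  have h: "conj_deg \<pi> (Suc h) \<le> Suc h"
    unfolding h_def by (rule LeastI[of _ "length \<pi>"]) (simp add: conj_deg_le_length le_SucI)
  have "h \<le> length \<pi>" unfolding h_def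
    by (rule Least_le) (simp add: conj_deg_le_length le_SucI)
  moreover have "j < conj_deg \<pi> j" if "1 \<le> j" "j \<le> h" for j
  proof -
    have "j - 1 < h" using that by linarith
    then show ?thesis
      using not_less_Least[of "j - 1" "\<lambda>h. conj_deg \<pi> (Suc h) \<le> Suc h"] that(1)
      by (simp add: h_def)
  qed
  moreover have "conj_deg \<pi> j \<le> j" if "h < j" for j
    using h conj_deg_antimono[of "Suc h" j \<pi>] that by linarith
  ultimately show thesis using that beta_part_eq by blast
qed

text \<open>
  Both lengths being \<open>k\<close> pins down the \<open>(k + 1)\<close>-st degree. Counting the cells of the Ferrers
  diagram of \<open>\<pi>\<close> by rows above and by columns below the \<open>k\<close>-th row turns the equality of the two
  sums into equality in the Erdos-Gallai inequality at \<open>k\<close>.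
\<close>

lemma degree_sequence_of_A_block:
  assumes sorted: "sorted_wrt (\<ge>) \<pi>" and "0 < k"
    and block: "(alpha_part \<pi>, beta_part \<pi>) \<in> A_blocks n k"
  shows "k < length \<pi>" "\<pi> ! k = k"
    and "\<And>i. i < k \<Longrightarrow> \<pi> ! (k - 1) \<le> \<pi> ! i"
    and "k \<le> \<pi> ! (k - 1)"
    and "(\<Sum>i<k. \<pi> ! i) = k * (k - 1) + (\<Sum>i=k..<length \<pi>. \<pi> ! i)"
    and "last (alpha_part \<pi>) = \<pi> ! (k - 1) - (k - 1)"
    and "last (beta_part \<pi>) = card {i \<in> {k..<length \<pi>}. \<pi> ! i = k}"
proof -
  have len: "length (alpha_part \<pi>) = k" "length (beta_part \<pi>) = k"
    and sums: "sum_list (alpha_part \<pi>) = n" "sum_list (beta_part \<pi>) = n"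
    using block by (auto simp: A_blocks_iff Dis_parts_def Dis_def)
  obtain h where "h \<le> length \<pi>" "\<And>i. i < h \<Longrightarrow> i < \<pi> ! i"
    "\<And>i. h \<le> i \<Longrightarrow> i < length \<pi> \<Longrightarrow> \<pi> ! i \<le> i"
    "alpha_part \<pi> = map (\<lambda>i. \<pi> ! i - i) [0..<h]"
    by (rule alpha_part_sorted[OF sorted]) blast
  moreover from this have "h = k" using len(1) by simp
  ultimately have k_le: "k \<le> length \<pi>" and low: "\<And>i. i < k \<Longrightarrow> i < \<pi> ! i"
    and high: "\<And>i. k \<le> i \<Longrightarrow> i < length \<pi> \<Longrightarrow> \<pi> ! i \<le> i"
    and alpha: "alpha_part \<pi> = map (\<lambda>i. \<pi> ! i - i) [0..<k]" by blast+
  obtain h where "\<And>j. 1 \<le> j \<Longrightarrow> j \<le> h \<Longrightarrow> j < conj_deg \<pi> j"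
    "beta_part \<pi> = map (\<lambda>j. conj_deg \<pi> (Suc j) - Suc j) [0..<h]"
    by (rule beta_part_obtain[of \<pi>]) blast
  moreover from this have "h = k" using len(2) by simp
  ultimately have conj: "\<And>j. 1 \<le> j \<Longrightarrow> j \<le> k \<Longrightarrow> j < conj_deg \<pi> j"
    and beta: "beta_part \<pi> = map (\<lambda>j. conj_deg \<pi> (Suc j) - Suc j) [0..<k]" by blast+
  have mono: "\<pi> ! j \<le> \<pi> ! i" if "i \<le> j" "j < length \<pi>" for i j
    using sorted that by (cases "i = j") (auto simp: sorted_wrt_iff_nth_less)
  then show first: "\<pi> ! (k - 1) \<le> \<pi> ! i" if "i < k" for i
    using that k_le by simp
  show last: "k \<le> \<pi> ! (k - 1)" using low[of "k - 1"] assms(2) by simp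
  \<comment> \<open>More than \<open>k\<close> degrees are at least \<open>k\<close>, since \<open>beta_part\<close> has a \<open>k\<close>-th part; the one at
    position \<open>k\<close> is at most \<open>k\<close>, since \<open>alpha_part\<close> has no further part.\<close>
  have "\<not> {i. i < length \<pi> \<and> k \<le> \<pi> ! i} \<subseteq> {..<k}"
    using conj[of k] assms(2) card_mono[of "{..<k}" "{i. i < length \<pi> \<and> k \<le> \<pi> ! i}"]
    by (auto simp: conj_deg_def)
  then obtain i where i: "i < length \<pi>" "k \<le> \<pi> ! i" "k \<le> i" by (auto simp: subset_iff not_less)
  then show "k < length \<pi>" by simp
  then show k: "\<pi> ! k = k" using mono[of k i] i high[of k] by simp
  then have rest_le: "\<pi> ! i \<le> k" if "i \<in> {k..<length \<pi>}" for i
    using mono[of k i] that by simp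
  have conj_eq: "conj_deg \<pi> j = k + card {i \<in> {k..<length \<pi>}. j \<le> \<pi> ! i}" if "j \<le> k" for j
  proof -
    have "{i. i < length \<pi> \<and> j \<le> \<pi> ! i} = {..<k} \<union> {i \<in> {k..<length \<pi>}. j \<le> \<pi> ! i}"
      using that last first k_le by fastforce
    then have "conj_deg \<pi> j = card ({..<k} \<union> {i \<in> {k..<length \<pi>}. j \<le> \<pi> ! i})"
      by (simp add: conj_deg_def)
    also have "\<dots> = card {..<k} + card {i \<in> {k..<length \<pi>}. j \<le> \<pi> ! i}"
      by (rule card_Un_disjoint) auto
    finally show ?thesis by simp
  qed
  have "n + (\<Sum>i<k. i) = (\<Sum>i<k. \<pi> ! i)"
  proof -
    have "n = (\<Sum>i<k. \<pi> ! i - i)"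
      using sums(1) by (simp add: alpha interv_sum_list_conv_sum_set_nat atLeast0LessThan)
    also have "\<dots> + (\<Sum>i<k. i) = (\<Sum>i<k. \<pi> ! i)"
      using low by (subst sum.distrib[symmetric]) (auto intro!: sum.cong simp: less_imp_le)
    finally show ?thesis .
  qed
  moreover have "n + (\<Sum>j<k. Suc j) = k * k + (\<Sum>i=k..<length \<pi>. \<pi> ! i)"
  proof -
    have "n = (\<Sum>j<k. conj_deg \<pi> (Suc j) - Suc j)"
      using sums(2) by (simp add: beta interv_sum_list_conv_sum_set_nat atLeast0LessThan)
    also have "\<dots> + (\<Sum>j<k. Suc j) = (\<Sum>j<k. conj_deg \<pi> (Suc j))"
    proof -
      have "conj_deg \<pi> (Suc j) - Suc j + Suc j = conj_deg \<pi> (Suc j)" if "j < k" for j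
        using conj[of "Suc j"] that by simp
      then show ?thesis by (subst sum.distrib[symmetric]) (intro sum.cong, auto)
    qed
    also have "\<dots> = (\<Sum>j<k. k + card {i \<in> {k..<length \<pi>}. Suc j \<le> \<pi> ! i})"
      by (intro sum.cong) (auto simp: conj_eq)
    also have "\<dots> = k * k + (\<Sum>j<k. card {i \<in> {k..<length \<pi>}. Suc j \<le> \<pi> ! i})"
      by (simp add: sum.distrib)
    also have "(\<Sum>j<k. card {i \<in> {k..<length \<pi>}. Suc j \<le> \<pi> ! i})
        = (\<Sum>i=k..<length \<pi>. \<pi> ! i)"
    proof (rule sum_multicount_gen)
      have "{j \<in> {..<k}. Suc j \<le> \<pi> ! i} = {..<\<pi> ! i}" if "i \<in> {k..<length \<pi>}" for i
        using rest_le[OF that] by auto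
      then show "\<forall>i\<in>{k..<length \<pi>}. card {j \<in> {..<k}. Suc j \<le> \<pi> ! i} = \<pi> ! i"
        by simp
    qed auto
    finally show ?thesis .
  qed
  moreover have "(\<Sum>j<k. Suc j) = k + (\<Sum>j<k. j)" by (simp add: sum_Suc)
  moreover have "k * k = k * (k - 1) + k" using assms(2) by (cases k) auto
  ultimately show "(\<Sum>i<k. \<pi> ! i) = k * (k - 1) + (\<Sum>i=k..<length \<pi>. \<pi> ! i)"
    by linarith
  show "last (alpha_part \<pi>) = \<pi> ! (k - 1) - (k - 1)"
    using assms(2) by (simp add: alpha last_map)
  have "last (beta_part \<pi>) = card {i \<in> {k..<length \<pi>}. k \<le> \<pi> ! i}"
    using assms(2) by (simp add: beta last_map conj_eq)
  also have "{i \<in> {k..<length \<pi>}. k \<le> \<pi> ! i} = {i \<in> {k..<length \<pi>}. \<pi> ! i = k}"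
    using rest_le by force
  finally show "last (beta_part \<pi>) = card {i \<in> {k..<length \<pi>}. \<pi> ! i = k}" .
qed


section \<open>Graphs whose block has two partitions of equal length\<close>

text \<open>
  Equality in the Erdos-Gallai inequality. The edges between \<open>T\<close> and its complement contribute
  equally to both degree sums and cancel; what remains says that the degrees inside \<open>T\<close> exceed
  those inside the complement by \<open>|T| (|T| - 1)\<close>, which is already the largest possible value of the
  former alone.
\<close>

lemma clique_indep_of_degree_sum:
  assumes G: "simple_graph V E" and T: "T \<subseteq> V"
    and sum: "(\<Sum>v\<in>T. vdeg E v) = card T * (card T - 1) + (\<Sum>v\<in>V - T. vdeg E v)"
  shows "clique T E" "indep (V - T) E"
proof -
  have fin: "finite V" using G by (simp add: simple_graph_def)
  have finT: "finite T" and finR: "finite (V - T)" using fin T finite_subset by auto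
  have split: "vdeg E v = card {u \<in> T. {v, u} \<in> E} + card {u \<in> V - T. {v, u} \<in> E}" for v
  proof -
    have "{u \<in> V. {v, u} \<in> E} = {u \<in> T. {v, u} \<in> E} \<union> {u \<in> V - T. {v, u} \<in> E}"
      using T by auto
    moreover have "card \<dots> = card {u \<in> T. {v, u} \<in> E} + card {u \<in> V - T. {v, u} \<in> E}"
      using finT finR by (intro card_Un_disjoint) auto
    ultimately show ?thesis by (simp add: vdeg_eq_card_nbrs[OF G])
  qed
  have cross: "(\<Sum>v\<in>T. card {u \<in> V - T. {v, u} \<in> E}) = (\<Sum>v\<in>V - T. card {u \<in> T. {v, u} \<in> E})"
    using finT finR by (intro sum_multicount_gen) (auto simp: insert_commute)
  have sub: "{u \<in> T. {v, u} \<in> E} \<subseteq> T - {v}" for v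
    using edge_distinct[OF G] by auto
  have le: "card {u \<in> T. {v, u} \<in> E} \<le> card T - 1" if "v \<in> T" for v
    using card_mono[OF _ sub[of v]] finT that by simp
  have "(\<Sum>v\<in>T. card {u \<in> T. {v, u} \<in> E})
      = card T * (card T - 1) + (\<Sum>v\<in>V - T. card {u \<in> V - T. {v, u} \<in> E})"
    using sum cross by (simp add: split sum.distrib)
  moreover have "(\<Sum>v\<in>T. card {u \<in> T. {v, u} \<in> E}) \<le> card T * (card T - 1)"
    using sum_bounded_above[of T "\<lambda>v. card {u \<in> T. {v, u} \<in> E}" "card T - 1"] le by simp
  ultimately have inner: "(\<Sum>v\<in>T. card {u \<in> T. {v, u} \<in> E}) = (\<Sum>v\<in>T. card T - 1)"
    and outer: "(\<Sum>v\<in>V - T. card {u \<in> V - T. {v, u} \<in> E}) = 0" by auto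
  have full: "card {u \<in> T. {v, u} \<in> E} = card T - 1" if "v \<in> T" for v
    using sum_mono_inv[OF inner le that finT] .
  have "{u \<in> T. {v, u} \<in> E} = T - {v}" if "v \<in> T" for v
    using full[OF that] that finT by (intro card_subset_eq sub) auto
  then show "clique T E" by (auto simp: clique_def)
  have "{u \<in> V - T. {v, u} \<in> E} = {}" if "v \<in> V - T" for v
  proof -
    have "card {u \<in> V - T. {v, u} \<in> E} = 0"
      using outer finR that by (simp only: sum_eq_0_iff)
    moreover have "finite {u \<in> V - T. {v, u} \<in> E}"
      using finR by (rule rev_finite_subset) blast
    ultimately show ?thesis by (simp only: card_0_eq)
  qed
  then show "indep (V - T) E" unfolding indep_def by blast
qed

text \<open>
  The \<open>k\<close> vertices of largest degree form the clique \<open>T\<close>. The next vertex \<open>r\<close> has degree \<open>k\<close> and,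
  lying in the stable part, spends it on all of \<open>T\<close>.
\<close>

lemma A_block_graph_split:
  assumes G: "simple_graph V E" and "0 < k"
    and block: "(alpha_part (degree_sequence V E), beta_part (degree_sequence V E)) \<in> A_blocks n k"
  obtains T r where "card T = k" "T \<subseteq> V" "r \<in> V - T" "clique (insert r T) E" "indep (V - T) E"
    and "2 \<le> last (alpha_part (degree_sequence V E)) \<longleftrightarrow> (\<forall>v\<in>T. k < vdeg E v)"
    and "last (beta_part (degree_sequence V E)) = card {v \<in> V - T. vdeg E v = k}"
proof -
  have fin: "finite V" using G by (simp add: simple_graph_def)
  obtain vs where vs: "distinct vs" "set vs = V" "sorted_wrt (\<ge>) (map (vdeg E) vs)"
    using ex_degree_ordering[OF fin] .
  let ?\<pi> = "map (vdeg E) vs"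
  have \<pi>: "degree_sequence V E = ?\<pi>" using degree_sequence_eq[OF vs] .
  note D = degree_sequence_of_A_block[OF vs(3) assms(2) block[unfolded \<pi>]]
  have len: "k < length vs" using D(1) by simp
  have inj: "inj_on ((!) vs) {..<length vs}"
    using vs(1) by (simp add: inj_on_nth)
  have injs: "inj_on ((!) vs) I" if "I \<subseteq> {..<length vs}" for I
    using inj_on_subset[OF inj that] .
  define T where "T = (!) vs ` {..<k}"
  define r where "r = vs ! k"
  have V: "V = (!) vs ` {..<length vs}"
    using vs(2) by (auto simp: in_set_conv_nth)
  have R: "V - T = (!) vs ` {k..<length vs}"
  proof -
    have "V - T = (!) vs ` ({..<length vs} - {..<k})"
      unfolding V T_def using len by (intro inj_on_image_set_diff[OF inj, symmetric]) auto
    also have "{..<length vs} - {..<k} = {k..<length vs}" by auto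
    finally show ?thesis .
  qed
  have card_T: "card T = k" unfolding T_def using len by (subst card_image[OF injs]) auto
  have T: "T \<subseteq> V" using len by (auto simp: V T_def)
  have r: "r \<in> V - T" using len by (auto simp: R r_def)
  have deg_r: "vdeg E r = k" using D(2) len by (simp add: r_def)
  have sum_T: "(\<Sum>v\<in>T. vdeg E v) = (\<Sum>i<k. ?\<pi> ! i)"
    unfolding T_def using len by (subst sum.reindex[OF injs]) (auto intro: sum.cong)
  have sum_R: "(\<Sum>v\<in>V - T. vdeg E v) = (\<Sum>i=k..<length ?\<pi>. ?\<pi> ! i)"
    unfolding R by (subst sum.reindex[OF injs]) (auto intro: sum.cong)
  have T_R: "clique T E" "indep (V - T) E"
    using clique_indep_of_degree_sum[OF G T] sum_T sum_R D(5) card_T by auto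
  have "{u \<in> V. {r, u} \<in> E} \<subseteq> T"
    using T_R(2) r edge_distinct[OF G] by (auto simp: indep_def)
  moreover have "card {u \<in> V. {r, u} \<in> E} = card T"
    using deg_r vdeg_eq_card_nbrs[OF G, of r] card_T by simp
  ultimately have "{u \<in> V. {r, u} \<in> E} = T"
    using finite_subset[OF T fin] by (intro card_subset_eq)
  then have "clique (insert r T) E"
    using T_R(1) r by (auto simp: clique_def insert_commute)
  moreover have "2 \<le> last (alpha_part ?\<pi>) \<longleftrightarrow> (\<forall>v\<in>T. k < vdeg E v)"
  proof -
    have "2 \<le> last (alpha_part ?\<pi>) \<longleftrightarrow> k < ?\<pi> ! (k - 1)"
      using D(6) assms(2) by simp linarith
    also have "\<dots> \<longleftrightarrow> (\<forall>i<k. k < ?\<pi> ! i)"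
      using D(3) assms(2) by (metis diff_less less_le_trans zero_less_one)
    also have "\<dots> \<longleftrightarrow> (\<forall>v\<in>T. k < vdeg E v)" using len by (auto simp: T_def)
    finally show ?thesis .
  qed
  moreover have "last (beta_part ?\<pi>) = card {v \<in> V - T. vdeg E v = k}"
  proof -
    have "{v \<in> V - T. vdeg E v = k} = (!) vs ` {i \<in> {k..<length ?\<pi>}. ?\<pi> ! i = k}"
      unfolding R by auto
    then show ?thesis using D(7) by (simp add: card_image[OF injs] subset_eq)
  qed
  ultimately show thesis
    using that[OF card_T T r] T_R \<pi> by simp
qed


section \<open>Realizing blocks by graphs\<close>

text \<open>
  Think of \<open>f\<close> as the rows of a 0-1 matrix. A longer row has a 1 in some column where a shorter row
  has a 0; exchanging the two entries keeps all column sums.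
\<close>

lemma move_element:
  fixes f :: "nat \<Rightarrow> 'a set"
  assumes fin: "\<And>i. i < k \<Longrightarrow> finite (f i)" and ij: "i < k" "j < k" "card (f j) < card (f i)"
  obtains g where "\<And>l. l < k \<Longrightarrow> finite (g l)" "card (g i) = card (f i) - 1"
    "card (g j) = card (f j) + 1" "\<And>l. l \<noteq> i \<Longrightarrow> l \<noteq> j \<Longrightarrow> g l = f l"
    "\<And>x. card {l. l < k \<and> x \<in> g l} = card {l. l < k \<and> x \<in> f l}"
proof -
  have "\<not> f i \<subseteq> f j" using card_mono[OF fin[OF ij(2)]] ij(3) by (meson not_le)
  then obtain y where y: "y \<in> f i" "y \<notin> f j" by blast
  have "i \<noteq> j" using ij(3) by auto
  define g where "g = f(i := f i - {y}, j := insert y (f j))"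
  have "card {l. l < k \<and> x \<in> g l} = card {l. l < k \<and> x \<in> f l}" for x
  proof (cases "x = y")
    case True
    let ?L = "{l. l < k \<and> y \<in> f l}"
    have "{l. l < k \<and> y \<in> g l} = insert j (?L - {i})"
      using y ij \<open>i \<noteq> j\<close> by (auto simp: g_def split: if_splits)
    moreover have "card (insert j (?L - {i})) = Suc (card (?L - {i}))"
      using y by (intro card_insert_disjoint) auto
    moreover have "\<dots> = card ?L" using y ij by (intro card_Suc_Diff1) auto
    ultimately show ?thesis using True by simp
  next
    case False
    then have "x \<in> g l \<longleftrightarrow> x \<in> f l" for l by (auto simp: g_def)
    then show ?thesis by simp
  qed
  moreover have "finite (g l)" if "l < k" for l using fin ij that by (simp add: g_def)
  moreover have "card (g i) = card (f i) - 1" "card (g j) = card (f j) + 1"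
    using y fin ij \<open>i \<noteq> j\<close> by (auto simp: g_def)
  moreover have "g l = f l" if "l \<noteq> i" "l \<noteq> j" for l using that by (simp add: g_def)
  ultimately show thesis using that by blast
qed

text \<open>
  One half of the Gale-Ryser theorem. If the row sums are not yet the target \<open>c\<close>, let \<open>i\<close> be the
  first row where they differ from it and \<open>j\<close> the first row that is too short. By domination row
  \<open>i\<close> is too long, so \<open>i < j\<close>, and as \<open>c\<close> decreases, row \<open>i\<close> is longer than row \<open>j\<close>. Moving an
  element from \<open>i\<close> to \<open>j\<close> lowers only the partial sums that end between them, and those were
  strictly larger than required. The total surplus over the target shrinks.
\<close>

lemma Gale_Ryser:
  fixes f :: "nat \<Rightarrow> 'a set" and c :: "nat \<Rightarrow> nat"
  assumes "\<And>i. i < k \<Longrightarrow> finite (f i)"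
    and "\<And>i j. i \<le> j \<Longrightarrow> j < k \<Longrightarrow> c j \<le> c i"
    and "\<And>m. m \<le> k \<Longrightarrow> (\<Sum>i<m. c i) \<le> (\<Sum>i<m. card (f i))"
    and "(\<Sum>i<k. c i) = (\<Sum>i<k. card (f i))"
  shows "\<exists>g :: nat \<Rightarrow> 'a set. (\<forall>i<k. finite (g i) \<and> card (g i) = c i) \<and>
    (\<forall>x. card {i. i < k \<and> x \<in> g i} = card {i. i < k \<and> x \<in> f i})"
  using assms(1,3,4)
proof (induction "\<Sum>i<k. card (f i) - c i" arbitrary: f rule: less_induct)
  case less
  note fin = less.prems(1) and dom = less.prems(2) and total = less.prems(3)
  show ?case
  proof (cases "\<forall>i<k. card (f i) = c i")
    case True
    then show ?thesis using fin by blast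
  next
    case False
    define i where "i = (LEAST i. i < k \<and> card (f i) \<noteq> c i)"
    have i: "i < k" "card (f i) \<noteq> c i"
      using LeastI_ex[of "\<lambda>i. i < k \<and> card (f i) \<noteq> c i"] False by (auto simp: i_def)
    have before: "card (f l) = c l" if "l < i" for l
      using not_less_Least[of l "\<lambda>i. i < k \<and> card (f i) \<noteq> c i"] that i by (auto simp: i_def)
    then have sum_before: "(\<Sum>l<i. c l) = (\<Sum>l<i. card (f l))" by simp
    then have gt: "c i < card (f i)"
      using dom[of "Suc i"] i by simp
    have "\<exists>j. j < k \<and> card (f j) < c j"
    proof (rule ccontr)
      assume "\<not> ?thesis"
      then have "\<forall>l\<in>{..<k}. c l \<le> card (f l)" by (meson leI lessThan_iff)
      then have "(\<Sum>l<k. c l) < (\<Sum>l<k. card (f l))"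
        using i gt by (intro sum_strict_mono_ex1) auto
      then show False using total by simp
    qed
    define j where "j = (LEAST j. j < k \<and> card (f j) < c j)"
    have j: "j < k" "card (f j) < c j"
      using LeastI_ex[OF \<open>\<exists>j. j < k \<and> card (f j) < c j\<close>] by (auto simp: j_def)
    have upto: "c l \<le> card (f l)" if "l < j" for l
      using not_less_Least[of l "\<lambda>j. j < k \<and> card (f j) < c j"] that j by (auto simp: j_def)
    have "i < j" using before j gt by (metis less_asym' linorder_neqE_nat)
    then have "card (f j) < card (f i)" using j gt assms(2)[of i j] by simp
    with fin i j obtain g where g: "\<And>l. l < k \<Longrightarrow> finite (g l)" "card (g i) = card (f i) - 1"
      "card (g j) = card (f j) + 1" "\<And>l. l \<noteq> i \<Longrightarrow> l \<noteq> j \<Longrightarrow> g l = f l"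
      "\<And>x. card {l. l < k \<and> x \<in> g l} = card {l. l < k \<and> x \<in> f l}"
      using move_element[of k f i j] by blast
    \<comment> \<open>One equation without truncated subtraction, from which all partial sums follow.\<close>
    have card_g: "card (g l) + (if l = i then 1 else 0) = card (f l) + (if l = j then 1 else 0)" for l
      using g(2-4) gt \<open>i < j\<close> by auto
    have sum_g: "(\<Sum>l<m. card (g l)) + (if i < m then 1 else 0)
        = (\<Sum>l<m. card (f l)) + (if j < m then 1 else 0)" for m
    proof -
      have "(\<Sum>l<m. card (g l) + (if l = i then 1 else 0))
          = (\<Sum>l<m. card (f l) + (if l = j then 1 else 0))"
        by (simp only: card_g)
      then show ?thesis by (simp add: sum.distrib)
    qed
    have "(\<Sum>l<m. c l) \<le> (\<Sum>l<m. card (g l))" if "m \<le> k" for m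
    proof (cases "i < m \<and> m \<le> j")
      case True
      have "(\<Sum>l<m. c l) < (\<Sum>l<m. card (f l))"
        using True gt upto by (intro sum_strict_mono_ex1) auto
      then show ?thesis using sum_g[of m] True by simp
    next
      case False
      then have "(\<Sum>l<m. card (g l)) = (\<Sum>l<m. card (f l))"
        using sum_g[of m] \<open>i < j\<close> by (auto split: if_splits)
      then show ?thesis using dom[OF that] by simp
    qed
    moreover have "(\<Sum>l<k. c l) = (\<Sum>l<k. card (g l))"
      using sum_g[of k] i j total by simp
    moreover have "(\<Sum>l<k. card (g l) - c l) < (\<Sum>l<k. card (f l) - c l)"
    proof (rule sum_strict_mono_ex1)
      show "\<forall>l\<in>{..<k}. card (g l) - c l \<le> card (f l) - c l"
        using g(2-4) j by (metis Suc_eq_plus1 Suc_leI diff_is_0_eq diff_le_mono diff_le_self le0 order_refl)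
      show "\<exists>l\<in>{..<k}. card (g l) - c l < card (f l) - c l"
        using i(1) g(2) gt by (intro bexI[of _ i]) auto
    qed simp
    ultimately obtain g' :: "nat \<Rightarrow> 'a set" where "\<forall>i<k. finite (g' i) \<and> card (g' i) = c i"
      "\<forall>x. card {i. i < k \<and> x \<in> g' i} = card {i. i < k \<and> x \<in> g i}"
      using less.hyps[of g] g(1) by blast
    then show ?thesis using g(5) by auto
  qed
qed

lemma split_graph_of_rows:
  fixes g :: "nat \<Rightarrow> nat set"
  assumes g: "\<forall>i<k. g i \<subseteq> {..<N}"
  defines "E \<equiv> [{..<k}]\<^bsup>2\<^esup> \<union> {{i, k + r} | i r. i < k \<and> r \<in> g i}"
  shows "simple_graph {..<k + N} E"
    and "\<And>i. i < k \<Longrightarrow> vdeg E i = k - 1 + card (g i)"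
    and "\<And>r. r < N \<Longrightarrow> vdeg E (k + r) = card {i. i < k \<and> r \<in> g i}"
proof -
  show simple: "simple_graph {..<k + N} E"
    using g by (fastforce simp: simple_graph_def E_def nsets_2_eq)
  show "vdeg E i = k - 1 + card (g i)" if i: "i < k" for i
  proof -
    have "{u \<in> {..<k + N}. {i, u} \<in> E} = ({..<k} - {i}) \<union> (+) k ` g i"
      using i g[rule_format, OF i] by (auto simp: E_def doubleton_eq_iff)
    moreover have "finite (g i)" using g i finite_subset by blast
    ultimately have "vdeg E i = card ({..<k} - {i}) + card ((+) k ` g i)"
      unfolding vdeg_eq_card_nbrs[OF simple] by (simp only:) (subst card_Un_disjoint, auto)
    then show ?thesis using i by (simp add: card_image)
  qed
  show "vdeg E (k + r) = card {i. i < k \<and> r \<in> g i}" if "r < N" for r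
  proof -
    have "{u \<in> {..<k + N}. {k + r, u} \<in> E} = {i. i < k \<and> r \<in> g i}"
      by (auto simp: E_def doubleton_eq_iff)
    then show ?thesis by (simp add: vdeg_eq_card_nbrs[OF simple])
  qed
qed

text \<open>
  Put a clique on \<open>k\<close> vertices and attach stable vertices so that the \<open>i\<close>-th clique vertex gets one
  neighbour more than the \<open>i\<close>-th excess of \<open>\<alpha>\<close>, which makes its degree right. The condition on \<open>\<beta>\<close>
  prescribes the conjugate of the degrees on the stable side: it consists of the excesses of \<open>\<beta>\<close>,
  each increased by one. Rows of these lengths, aligned at the left, have the right column sums,
  and because \<open>\<beta>\<close> majorizes \<open>\<alpha>\<close> the rows can be changed to the lengths wanted for \<open>\<alpha>\<close> with the
  columns kept.
\<close>

lemma A_block_realizable: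
  assumes block: "(\<alpha>, \<beta>) \<in> A_blocks n k" and "0 < k"
  obtains V :: "nat set" and E where "simple_graph V E" "no_isolated_vertices V E"
    "alpha_part (degree_sequence V E) = \<alpha>" "beta_part (degree_sequence V E) = \<beta>"
proof -
  have ab: "\<alpha> \<in> Dis_parts k n" "\<beta> \<in> Dis_parts k n" "\<beta> \<succeq> \<alpha>" using block by (auto simp: A_blocks_iff)
  let ?a = "excess \<alpha>" and ?b = "excess \<beta>"
  define N where "N = Suc (?b 0)"
  define f where "f = (\<lambda>i. {..?b i})"
  have "(\<Sum>i<m. Suc (?a i)) \<le> (\<Sum>i<m. card (f i))" if "m \<le> k" for m
    using majorizes_iff_excess[OF ab(1,2)] ab(3) that by (simp add: f_def sum_Suc)
  moreover have "(\<Sum>i<k. Suc (?a i)) = (\<Sum>i<k. card (f i))"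
    using sum_excess[OF ab(1)] sum_excess[OF ab(2)] by (simp add: f_def sum_Suc)
  ultimately have "\<exists>g :: nat \<Rightarrow> nat set.
      (\<forall>i<k. finite (g i) \<and> card (g i) = Suc (?a i)) \<and>
      (\<forall>r. card {i. i < k \<and> r \<in> g i} = card {i. i < k \<and> r \<in> f i})"
    using excess_antimono[OF ab(1)] by (intro Gale_Ryser) (auto simp: f_def)
  then obtain g :: "nat \<Rightarrow> nat set" where
    g: "\<And>i. i < k \<Longrightarrow> finite (g i)" "\<And>i. i < k \<Longrightarrow> card (g i) = Suc (?a i)"
    and col: "\<And>r. card {i. i < k \<and> r \<in> g i} = card {i. i < k \<and> r \<in> f i}"
    by blast
  have b_le: "?b i \<le> ?b 0" if "i < k" for i using excess_antimono[OF ab(2)] that by simp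
  have g_N: "\<forall>i<k. g i \<subseteq> {..<N}"
  proof (intro allI impI subsetI)
    fix i r assume "i < k" "r \<in> g i"
    then have "{i. i < k \<and> r \<in> g i} \<noteq> {}" by blast
    then have "card {i. i < k \<and> r \<in> f i} \<noteq> 0" unfolding col[symmetric] by simp
    then obtain l where "l < k" "r \<le> ?b l" by (auto simp: f_def)
    then show "r \<in> {..<N}" using b_le[of l] by (simp add: N_def)
  qed
  define E where "E = [{..<k}]\<^bsup>2\<^esup> \<union> {{i, k + r} | i r. i < k \<and> r \<in> g i}"
  \<comment> \<open>Listed in the natural order, the vertices have decreasing degrees.\<close>
  let ?V = "{..<k + N}" and ?vs = "[0..<k + N]"
  let ?\<pi> = "map (vdeg E) ?vs"
  note graph = split_graph_of_rows[of k g N, folded E_def, OF g_N]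
  have deg_T: "vdeg E i = k + ?a i" if "i < k" for i
    using graph(2)[OF that] g(2)[OF that] assms(2) by simp
  have deg_R: "vdeg E (k + r) = card {i. i < k \<and> r \<le> ?b i}" if "r < N" for r
    using graph(3)[OF that] by (simp add: col f_def)
  have deg_R_le: "vdeg E v \<le> k" if "k \<le> v" "v < k + N" for v
  proof -
    have "card {i. i < k \<and> v - k \<le> ?b i} \<le> card {..<k}" by (intro card_mono) auto
    then show ?thesis using deg_R[of "v - k"] that by simp
  qed
  have mono: "vdeg E v \<le> vdeg E u" if "u < v" "v < k + N" for u v
  proof (cases "k \<le> u")
    case True
    have "card {i. i < k \<and> v - k \<le> ?b i} \<le> card {i. i < k \<and> u - k \<le> ?b i}"
      using that by (intro card_mono) auto
    then show ?thesis using deg_R[of "v - k"] deg_R[of "u - k"] that True by simp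
  next
    case False
    then show ?thesis
      using deg_T[of u] deg_T[of v] deg_R_le[of v] that excess_antimono[OF ab(1), of u v]
      by (cases "k \<le> v") auto
  qed
  then have "sorted_wrt (\<ge>) ?\<pi>" by (simp add: sorted_wrt_iff_nth_less)
  then have \<pi>: "degree_sequence ?V E = ?\<pi>"
    by (intro degree_sequence_eq) (auto simp: atLeast0LessThan)
  have "no_isolated_vertices ?V E"
  proof -
    have "vdeg E v \<noteq> 0" if "v < k + N" for v
    proof (cases "v < k")
      case False
      have "0 \<in> {i. i < k \<and> v - k \<le> ?b i}" using that False assms(2) by (simp add: N_def)
      then have "card {i. i < k \<and> v - k \<le> ?b i} \<noteq> 0" by auto
      then show ?thesis using deg_R[of "v - k"] that False by simp
    qed (use deg_T assms(2) in simp)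
    then show ?thesis by (simp add: no_isolated_vertices_def)
  qed
  moreover have "alpha_part ?\<pi> = \<alpha>"
  proof -
    have "alpha_part ?\<pi> = map (\<lambda>i. ?\<pi> ! i - i) [0..<k]"
    proof (rule alpha_part_eq)
      fix i assume "k \<le> i" "i < length ?\<pi>"
      then show "?\<pi> ! i \<le> i" using deg_R_le[of i] by simp
    qed (use deg_T in auto)
    also have "\<dots> = \<alpha>"
      using ab(1) nth_excess[OF ab(1)] deg_T
      by (intro nth_equalityI) (auto simp: Dis_parts_def)
    finally show ?thesis .
  qed
  moreover have "beta_part ?\<pi> = \<beta>"
  proof -
    have conj: "conj_deg ?\<pi> (Suc j) = k + Suc (?b j)" if "j < k" for j
    proof -
      have "Suc j \<le> vdeg E v \<longleftrightarrow> v \<le> k + ?b j" if "v < k + N" for v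
      proof (cases "v < k")
        case False
        have "card {i. i < k \<and> v - k \<le> ?b i} \<ge> Suc j \<longleftrightarrow> v - k \<le> ?b j"
        proof
          assume "v - k \<le> ?b j"
          then have "{..j} \<subseteq> {i. i < k \<and> v - k \<le> ?b i}"
            using excess_antimono[OF ab(2) _ \<open>j < k\<close>] \<open>j < k\<close> by (auto intro: order_trans)
          then show "card {i. i < k \<and> v - k \<le> ?b i} \<ge> Suc j"
            using card_mono[of "{i. i < k \<and> v - k \<le> ?b i}" "{..j}"] by simp
        next
          assume *: "card {i. i < k \<and> v - k \<le> ?b i} \<ge> Suc j"
          show "v - k \<le> ?b j"
          proof (rule ccontr)
            assume "\<not> v - k \<le> ?b j"
            then have "{i. i < k \<and> v - k \<le> ?b i} \<subseteq> {..<j}"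
              using excess_antimono[OF ab(2), of j] by (force simp: not_le)
            then have "card {i. i < k \<and> v - k \<le> ?b i} \<le> j"
              using card_mono[of "{..<j}" "{i. i < k \<and> v - k \<le> ?b i}"] by simp
            then show False using * by simp
          qed
        qed
        then show ?thesis using deg_R[of "v - k"] that False by auto
      qed (use deg_T \<open>j < k\<close> in simp)
      moreover have b_lt: "v < k + N" if "v \<le> k + ?b j" for v
        using b_le[OF \<open>j < k\<close>] that by (simp add: N_def)
      ultimately have "{i. i < length ?\<pi> \<and> Suc j \<le> ?\<pi> ! i} = {..k + ?b j}"
        using b_lt by auto
      then show ?thesis by (simp add: conj_deg_def)
    qed
    have "beta_part ?\<pi> = map (\<lambda>j. conj_deg ?\<pi> (Suc j) - Suc j) [0..<k]"
    proof (rule beta_part_eq)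
      fix j assume "1 \<le> j" "j \<le> k"
      then show "j < conj_deg ?\<pi> j" using conj[of "j - 1"] by simp
    next
      fix j assume "k < j"
      have "v < j" if "v < k + N" "j \<le> vdeg E v" for v
        using that deg_R_le[of v] \<open>k < j\<close> by (cases "k \<le> v") auto
      then have "{i. i < length ?\<pi> \<and> j \<le> ?\<pi> ! i} \<subseteq> {..<j}" by auto
      then show "conj_deg ?\<pi> j \<le> j"
        using card_mono[of "{..<j}" "{i. i < length ?\<pi> \<and> j \<le> ?\<pi> ! i}"]
        by (simp add: conj_deg_def)
    qed simp
    also have "\<dots> = \<beta>"
      using ab(2) nth_excess[OF ab(2)] conj
      by (intro nth_equalityI) (auto simp: Dis_parts_def)
    finally show ?thesis .
  qed
  ultimately show thesis using that[of ?V E] graph(1) \<pi> by simp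
qed

text \<open>
  By \<open>A_block_graph_split\<close> every graph with a block in \<open>A(n, k)\<close> decides its kind by the smallest
  parts alone, and by \<open>A_block_realizable\<close> there always is such a graph.
\<close>

lemma NG_blocks_eq:
  assumes "0 < k"
  shows "NG1 n k = {b \<in> A_blocks n k. last (snd b) = 1}"
    and "NG2 n k = {b \<in> A_blocks n k. 2 \<le> last (fst b)}"
proof -
  have kind: "(NG1_graph V E \<longleftrightarrow> last (snd b) = 1) \<and> (NG2_graph V E \<longleftrightarrow> 2 \<le> last (fst b))"
    if G: "simple_graph V E" "no_isolated_vertices V E" and "b \<in> A_blocks n k"
      and b: "fst b = alpha_part (degree_sequence V E)" "snd b = beta_part (degree_sequence V E)"
    for V :: "nat set" and E b
  proof -
    have "(alpha_part (degree_sequence V E), beta_part (degree_sequence V E)) \<in> A_blocks n k"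
      using that(3) b by (cases b) simp
    from A_block_graph_split[OF G(1) assms this]
    obtain T r where k: "card T = k"
      and T: "T \<subseteq> V" "r \<in> V - T" "clique (insert r T) E" "indep (V - T) E"
      and "2 \<le> last (alpha_part (degree_sequence V E)) \<longleftrightarrow> (\<forall>v\<in>T. k < vdeg E v)"
      and "last (beta_part (degree_sequence V E)) = card {v \<in> V - T. vdeg E v = k}" .
    then show ?thesis using NG_kind_split[OF G T] b by simp
  qed
  have realizable: "\<exists>(V :: nat set) E. simple_graph V E \<and> no_isolated_vertices V E \<and>
      fst b = alpha_part (degree_sequence V E) \<and> snd b = beta_part (degree_sequence V E)"
    if "b \<in> A_blocks n k" for b
    using A_block_realizable[of "fst b" "snd b" n k] that assms by (metis prod.collapse)
  have NG: "simple_graph V E \<and> no_isolated_vertices V E"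
    if "NG1_graph V E \<or> NG2_graph V E" for V :: "nat set" and E
    using that by (auto simp: NG1_graph_def NG2_graph_def NG_graph_def)
  have "NG1_block b \<longleftrightarrow> last (snd b) = 1" if b: "b \<in> A_blocks n k" for b
    unfolding NG1_block_def using kind[OF _ _ b] realizable[OF b] NG by metis
  then show "NG1 n k = {b \<in> A_blocks n k. last (snd b) = 1}" by (auto simp: NG1_def)
  have "NG2_block b \<longleftrightarrow> 2 \<le> last (fst b)" if b: "b \<in> A_blocks n k" for b
    unfolding NG2_block_def using kind[OF _ _ b] realizable[OF b] NG by metis
  then show "NG2 n k = {b \<in> A_blocks n k. 2 \<le> last (fst b)}" by (auto simp: NG2_def)
qed


section \<open>Smallest parts decide the kind of a block\<close>

text \<open>
  Membership in the four families of NG-blocks is decided by the smallest parts, which are monotone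
  along the order of blocks; this makes the starred families convex.
\<close>

lemma block_last_mono:
  assumes "p \<in> A_blocks n k" "q \<in> A_blocks n k" "p \<succeq>\<^sub>S q" "0 < k"
  shows "last (fst p) \<le> last (fst q)" "last (snd q) \<le> last (snd p)"
  using assms majorizes_last[of "fst q" k n "fst p"] majorizes_last[of "snd p" k n "snd q"]
  by (auto simp: A_blocks_def block_majorizes_def)

lemma A_block_last:
  assumes "b \<in> A_blocks n k" "0 < k"
  shows "0 < last (snd b)" "last (snd b) \<le> last (fst b)"
  using assms majorizes_last[of "fst b" k n "snd b"] last_pos[of "snd b" k n]
  by (auto simp: A_blocks_def S_Block_def)

lemma NG_star_blocks_eq:
  assumes "0 < k"
  shows "NG1_star n k = {b \<in> A_blocks n k. last (fst b) = 1 \<and> last (snd b) = 1}"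
    and "NG2_star n k = {b \<in> A_blocks n k. 2 \<le> last (fst b) \<and> 2 \<le> last (snd b)}"
proof -
  note A_block_last[OF _ assms]
  then show "NG1_star n k = {b \<in> A_blocks n k. last (fst b) = 1 \<and> last (snd b) = 1}"
    and "NG2_star n k = {b \<in> A_blocks n k. 2 \<le> last (fst b) \<and> 2 \<le> last (snd b)}"
    unfolding NG1_star_def NG2_star_def NG_blocks_eq[OF assms] by fastforce+
qed

theorem theorem4p25:
  fixes n k :: nat
  assumes "n > 0" and "k > 0" and "n \<ge> (k + 1) choose 2"
  shows "amphora_in (S_Block n) (\<succeq>\<^sub>S) (NG1_star n k) \<and>
         amphora_in (S_Block n) (\<succeq>\<^sub>S) (NG2_star n k) \<and>
         amphora_in (S_Block (n - k)) (\<succeq>\<^sub>S) (A_blocks (n - k) (k - 1)) \<and>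
         amphora_in (S_Block (n - k)) (\<succeq>\<^sub>S) (A_blocks (n - k) k) \<and>
         (\<exists>\<phi>. majorization_bijection \<phi> (NG1_star n k) (A_blocks (n - k) (k - 1))) \<and>
         (\<exists>\<psi>. majorization_bijection \<psi> (NG2_star n k) (A_blocks (n - k) k))"
proof -
  have "k \<le> (k + 1) choose 2" by (simp add: numeral_2_eq_2)
  then have "k \<le> n" using assms(3) by simp
  note last_mono = block_last_mono[OF _ _ _ assms(2)]
  note last = A_block_last[OF _ assms(2)]
  obtain \<phi> where \<phi>: "majorization_bijection \<phi> (A_blocks (n - k) (k - 1)) (NG1_star n k)"
    using bijection_raise_snoc[of "k - 1" n] \<open>k \<le> n\<close> assms(2)
    by (auto simp: NG_star_blocks_eq)
  obtain \<psi> where \<psi>: "majorization_bijection \<psi> (A_blocks (n - k) k) (NG2_star n k)"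
    using bijection_raise[OF \<open>k \<le> n\<close> assms(2)] by (auto simp: NG_star_blocks_eq assms(2))
  have "amphora_in (S_Block n) (\<succeq>\<^sub>S) (NG1_star n k)"
  proof (rule amphora_in_S_Block)
    fix x p a assume *: "x \<in> NG1_star n k" "a \<in> NG1_star n k" "p \<in> A_blocks n k"
      "p \<succeq>\<^sub>S x" "a \<succeq>\<^sub>S p"
    then have "last (fst p) \<le> 1" "last (snd p) \<le> 1"
      using last_mono[of p n x] last_mono[of a n p] by (auto simp: NG_star_blocks_eq assms(2))
    then show "p \<in> NG1_star n k"
      using * last[OF *(3)] by (simp add: NG_star_blocks_eq assms(2))
  qed (use majorization_bijection_least[OF \<phi>] in
      \<open>auto simp: NG_star_blocks_eq assms(2) A_blocks_iff majorizes_refl\<close>)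
  moreover have "amphora_in (S_Block n) (\<succeq>\<^sub>S) (NG2_star n k)"
  proof (rule amphora_in_S_Block)
    fix x p a assume *: "x \<in> NG2_star n k" "a \<in> NG2_star n k" "p \<in> A_blocks n k"
      "p \<succeq>\<^sub>S x" "a \<succeq>\<^sub>S p"
    then have "2 \<le> last (snd p)"
      using last_mono[of p n x] by (auto simp: NG_star_blocks_eq assms(2))
    then show "p \<in> NG2_star n k"
      using * last[OF *(3)] by (simp add: NG_star_blocks_eq assms(2))
  qed (use majorization_bijection_least[OF \<psi>] in
      \<open>auto simp: NG_star_blocks_eq assms(2) A_blocks_iff majorizes_refl\<close>)
  ultimately show ?thesis
    using amphora_A_blocks majorization_bijection_inv[OF \<phi>] majorization_bijection_inv[OF \<psi>] by blast
qed

end
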